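(* Let $D$ be a division ring and let $\mathcal V$ and $\mathcal W$ be vector spaces over $D$. (Right version) Let $\mathcal I$ be a right submodule of $\mathcal L(\mathcal V,\mathcal W)$. If the image ${\rm im}(\mathcal I)$ is finite-dimensional, then $\mathcal I$ is finitely generated, and hence $\mathcal I=\{T\in\mathcal L(\mathcal V,\mathcal W): T\mathcal V\subseteq {\rm im}(\mathcal I)\}$. Moreover, if $\dim\mathcal V\ge\dim\mathcal W$, then $\mathcal I$ is principal. (Left version) Let $\mathcal I$ be a left submodule of $\mathcal L(\mathcal V,\mathcal W)$. If the coimage ${\rm coim}(\mathcal I)=\mathcal V/\ker(\mathcal I)$ is finite-dimensional, then $\mathcal I$ is finitely generated, and hence $\mathcal I=\{T\in\mathcal L(\mathcal V,\mathcal W): T\ker(\mathcal I)=\{0\}\}$. Moreover, if $\dim\mathcal V\le\dim\mathcal W$, then $\mathcal I$ is principal.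
   Context: Vector spaces are right vector spaces over the division ring $D$, of arbitrary (possibly infinite) dimension; dimensions are cardinal numbers. $\mathcal L(\mathcal V,\mathcal W)$ is the abelian group of all $D$-linear maps $\mathcal V\to\mathcal W$, and $\mathcal L(\mathcal V)=\mathcal L(\mathcal V,\mathcal V)$ is a ring under addition and composition. By composition, $\mathcal L(\mathcal V,\mathcal W)$ is a right $\mathcal L(\mathcal V)$-module and a left $\mathcal L(\mathcal W)$-module. A right (resp. left) submodule of $\mathcal L(\mathcal V,\mathcal W)$ means a right $\mathcal L(\mathcal V)$-submodule (resp. left $\mathcal L(\mathcal W)$-submodule); "finitely generated" and "principal" (generated by one element) refer to this module structure. For a family $\mathcal F\subseteq\mathcal L(\mathcal V,\mathcal W)$: ${\rm im}(\mathcal F)$ is the linear span of $\{Ax: A\in\mathcal F, x\in\mathcal V\}$ in $\mathcal W$, $\ker(\mathcal F)=\bigcap_{A\in\mathcal F}\ker A$, and ${\rm coim}(\mathcal F)=\mathcal V/\ker(\mathcal F)$. *)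

theory Defs
  imports "HOL.Hull" "HOL-Algebra.Module" "HOL-Algebra.AbelCoset" "HOL-Library.FuncSet"
begin

unbundle cardinal_syntax

text \<open>
  The modules of HOL-Algebra are left modules over commutative rings, so right modules over
  arbitrary rings are introduced here, on the same pattern: the record extends \<open>ring\<close> only to
  reuse its additive part, and the fields \<open>mult\<close> and \<open>one\<close> are never looked at.
\<close>

record ('a, 'b) right_module = "'b ring" +
  rsmult :: "['b, 'a] \<Rightarrow> 'b" (infixl "\<cdot>\<index>" 70)

locale right_module = R?: ring R + M?: abelian_group M
  for R (structure) and M (structure) +
  assumes rsmult_closed [simp, intro]:
      "\<lbrakk>x \<in> carrier M; a \<in> carrier R\<rbrakk> \<Longrightarrow> x \<cdot>\<^bsub>M\<^esub> a \<in> carrier M"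
    and rsmult_r_distr:
      "\<lbrakk>x \<in> carrier M; a \<in> carrier R; b \<in> carrier R\<rbrakk> \<Longrightarrow>
        x \<cdot>\<^bsub>M\<^esub> (a \<oplus>\<^bsub>R\<^esub> b) = (x \<cdot>\<^bsub>M\<^esub> a) \<oplus>\<^bsub>M\<^esub> (x \<cdot>\<^bsub>M\<^esub> b)"
    and rsmult_l_distr:
      "\<lbrakk>x \<in> carrier M; y \<in> carrier M; a \<in> carrier R\<rbrakk> \<Longrightarrow>
        (x \<oplus>\<^bsub>M\<^esub> y) \<cdot>\<^bsub>M\<^esub> a = (x \<cdot>\<^bsub>M\<^esub> a) \<oplus>\<^bsub>M\<^esub> (y \<cdot>\<^bsub>M\<^esub> a)"
    and rsmult_assoc:
      "\<lbrakk>x \<in> carrier M; a \<in> carrier R; b \<in> carrier R\<rbrakk> \<Longrightarrow>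
        x \<cdot>\<^bsub>M\<^esub> (a \<otimes>\<^bsub>R\<^esub> b) = (x \<cdot>\<^bsub>M\<^esub> a) \<cdot>\<^bsub>M\<^esub> b"
    and rsmult_one [simp]:
      "x \<in> carrier M \<Longrightarrow> x \<cdot>\<^bsub>M\<^esub> \<one>\<^bsub>R\<^esub> = x"

locale right_submodule = subgroup H "add_monoid M"
  for H and R :: "('a, 'm) ring_scheme" and M (structure) +
  assumes rsmult_closed [simp, intro]:
      "\<lbrakk>x \<in> H; a \<in> carrier R\<rbrakk> \<Longrightarrow> x \<cdot>\<^bsub>M\<^esub> a \<in> H"

text \<open>
  Generated submodules are hulls, i.e. intersections of all submodules above the given set;
  this is meaningful for \<open>S \<subseteq> carrier M\<close>. The library locale \<open>submodule\<close> itself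
  does not require the ring to be commutative, so it serves for left submodules.
\<close>

definition right_span :: "('a, 'm) ring_scheme \<Rightarrow> ('a, 'b, 'n) right_module_scheme \<Rightarrow> 'b set \<Rightarrow> 'b set"
  where "right_span R M S = (\<lambda>H. right_submodule H R M) hull S"

definition left_span :: "('a, 'm) ring_scheme \<Rightarrow> ('a, 'b, 'n) module_scheme \<Rightarrow> 'b set \<Rightarrow> 'b set"
  where "left_span R M S = (\<lambda>H. submodule H R M) hull S"

definition right_fin_gen :: "('a, 'm) ring_scheme \<Rightarrow> ('a, 'b, 'n) right_module_scheme \<Rightarrow> 'b set \<Rightarrow> bool"
  where "right_fin_gen R M I \<longleftrightarrow> (\<exists>S. finite S \<and> S \<subseteq> I \<and> I = right_span R M S)"

definition left_fin_gen :: "('a, 'm) ring_scheme \<Rightarrow> ('a, 'b, 'n) module_scheme \<Rightarrow> 'b set \<Rightarrow> bool"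
  where "left_fin_gen R M I \<longleftrightarrow> (\<exists>S. finite S \<and> S \<subseteq> I \<and> I = left_span R M S)"

definition right_principal :: "('a, 'm) ring_scheme \<Rightarrow> ('a, 'b, 'n) right_module_scheme \<Rightarrow> 'b set \<Rightarrow> bool"
  where "right_principal R M I \<longleftrightarrow> (\<exists>A\<in>I. I = right_span R M {A})"

definition left_principal :: "('a, 'm) ring_scheme \<Rightarrow> ('a, 'b, 'n) module_scheme \<Rightarrow> 'b set \<Rightarrow> bool"
  where "left_principal R M I \<longleftrightarrow> (\<exists>A\<in>I. I = left_span R M {A})"


section \<open>Right vector spaces over a division ring\<close>

text \<open>
  The condition on units is the one of the library locale \<open>field\<close>; it implies that
  zero and one are distinct.
\<close>

locale skew_field = ring D for D (structure) +
  assumes skew_field_Units: "Units D = carrier D - {\<zero>}"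

locale right_vector_space = right_module D V + skew_field D
  for D (structure) and V (structure)

definition lin_indep :: "('d, 'm) ring_scheme \<Rightarrow> ('d, 'v, 'n) right_module_scheme \<Rightarrow> 'v set \<Rightarrow> bool"
  where "lin_indep D V B \<longleftrightarrow>
    (\<forall>F u. finite F \<and> F \<subseteq> B \<and> u \<in> F \<rightarrow> carrier D \<and>
       (\<Oplus>\<^bsub>V\<^esub>x\<in>F. x \<cdot>\<^bsub>V\<^esub> u x) = \<zero>\<^bsub>V\<^esub> \<longrightarrow> (\<forall>x\<in>F. u x = \<zero>\<^bsub>D\<^esub>))"

definition is_basis :: "('d, 'm) ring_scheme \<Rightarrow> ('d, 'v, 'n) right_module_scheme \<Rightarrow> 'v set \<Rightarrow> bool"
  where "is_basis D V B \<longleftrightarrow>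
    B \<subseteq> carrier V \<and> lin_indep D V B \<and> right_span D V B = carrier V"

text \<open>
  The dimension is the cardinal number (as a well-order, to be compared by \<open>\<le>o\<close>) of a basis.
  Bases exist and any two of them are equipotent, so the choice does not matter.
\<close>

definition vdim :: "('d, 'm) ring_scheme \<Rightarrow> ('d, 'v, 'n) right_module_scheme \<Rightarrow> 'v rel"
  where "vdim D V = card_of (SOME B. is_basis D V B)"

definition fin_dim :: "('d, 'm) ring_scheme \<Rightarrow> ('d, 'v, 'n) right_module_scheme \<Rightarrow> bool"
  where "fin_dim D V \<longleftrightarrow> (\<exists>B. finite B \<and> is_basis D V B)"

text \<open>
  Scalar multiplication on the quotient: \<open>(x + U) a = x a + U\<close>, written as a union
  over all representatives \<open>x\<close> of the coset.
\<close>

definition quot_space :: "('d, 'v, 'n) right_module_scheme \<Rightarrow> 'v set \<Rightarrow> ('d, 'v set) right_module"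
  where "quot_space V U =
    \<lparr>carrier = a_rcosets\<^bsub>V\<^esub> U, monoid.mult = undefined, one = undefined,
     zero = U, add = (\<lambda>X Y. X <+>\<^bsub>V\<^esub> Y),
     rsmult = (\<lambda>X a. \<Union>x\<in>X. U +>\<^bsub>V\<^esub> (x \<cdot>\<^bsub>V\<^esub> a))\<rparr>"


section \<open>Linear maps\<close>

text \<open>
  A map \<open>V \<rightarrow> W\<close> is represented by a function that is \<open>undefined\<close> outside the carrier of
  \<open>V\<close>, so that equality of maps is equality of functions.
\<close>

definition lin_maps ::
  "('d, 'm) ring_scheme \<Rightarrow> ('d, 'v, 'n) right_module_scheme \<Rightarrow> ('d, 'w, 'k) right_module_scheme
    \<Rightarrow> ('v \<Rightarrow> 'w) set"
  where "lin_maps D V W =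
    {f \<in> carrier V \<rightarrow>\<^sub>E carrier W.
      (\<forall>x\<in>carrier V. \<forall>y\<in>carrier V. f (x \<oplus>\<^bsub>V\<^esub> y) = f x \<oplus>\<^bsub>W\<^esub> f y) \<and>
      (\<forall>x\<in>carrier V. \<forall>a\<in>carrier D. f (x \<cdot>\<^bsub>V\<^esub> a) = f x \<cdot>\<^bsub>W\<^esub> a)}"

definition End_ring :: "('d, 'm) ring_scheme \<Rightarrow> ('d, 'v, 'n) right_module_scheme \<Rightarrow> ('v \<Rightarrow> 'v) ring"
  where "End_ring D V =
    \<lparr>carrier = lin_maps D V V, monoid.mult = compose (carrier V), one = (\<lambda>x\<in>carrier V. x),
     zero = (\<lambda>x\<in>carrier V. \<zero>\<^bsub>V\<^esub>), add = (\<lambda>f g. \<lambda>x\<in>carrier V. f x \<oplus>\<^bsub>V\<^esub> g x)\<rparr>"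

text \<open>The group of linear maps from \<open>V\<close> to \<open>W\<close>, as a right module over \<open>End_ring D V\<close>
  and as a left module over \<open>End_ring D W\<close>.\<close>

definition Hom_right ::
  "('d, 'm) ring_scheme \<Rightarrow> ('d, 'v, 'n) right_module_scheme \<Rightarrow> ('d, 'w, 'k) right_module_scheme
    \<Rightarrow> ('v \<Rightarrow> 'v, 'v \<Rightarrow> 'w) right_module"
  where "Hom_right D V W =
    \<lparr>carrier = lin_maps D V W, monoid.mult = undefined, one = undefined,
     zero = (\<lambda>x\<in>carrier V. \<zero>\<^bsub>W\<^esub>), add = (\<lambda>f g. \<lambda>x\<in>carrier V. f x \<oplus>\<^bsub>W\<^esub> g x),
     rsmult = (\<lambda>f A. compose (carrier V) f A)\<rparr>"

definition Hom_left ::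
  "('d, 'm) ring_scheme \<Rightarrow> ('d, 'v, 'n) right_module_scheme \<Rightarrow> ('d, 'w, 'k) right_module_scheme
    \<Rightarrow> ('w \<Rightarrow> 'w, 'v \<Rightarrow> 'w) module"
  where "Hom_left D V W =
    \<lparr>carrier = lin_maps D V W, monoid.mult = undefined, one = undefined,
     zero = (\<lambda>x\<in>carrier V. \<zero>\<^bsub>W\<^esub>), add = (\<lambda>f g. \<lambda>x\<in>carrier V. f x \<oplus>\<^bsub>W\<^esub> g x),
     smult = (\<lambda>A f. compose (carrier V) A f)\<rparr>"

definition im_fam ::
  "('d, 'm) ring_scheme \<Rightarrow> ('d, 'v, 'n) right_module_scheme \<Rightarrow> ('d, 'w, 'k) right_module_scheme
    \<Rightarrow> ('v \<Rightarrow> 'w) set \<Rightarrow> 'w set"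
  where "im_fam D V W \<F> = right_span D W {A x | A x. A \<in> \<F> \<and> x \<in> carrier V}"

definition ker_fam ::
  "('d, 'v, 'n) right_module_scheme \<Rightarrow> ('d, 'w, 'k) right_module_scheme \<Rightarrow> ('v \<Rightarrow> 'w) set \<Rightarrow> 'v set"
  where "ker_fam V W \<F> = {x \<in> carrier V. \<forall>A\<in>\<F>. A x = \<zero>\<^bsub>W\<^esub>}"

definition coim_fam ::
  "('d, 'v, 'n) right_module_scheme \<Rightarrow> ('d, 'w, 'k) right_module_scheme \<Rightarrow> ('v \<Rightarrow> 'w) set
    \<Rightarrow> ('d, 'v set) right_module"
  where "coim_fam V W \<F> = quot_space V (ker_fam V W \<F>)"

end

theory Submission
  imports Defs
begin

text \<open>
  Maps of the form \<open>x \<mapsto> w \<cdot> f x\<close>, for a vector \<open>w\<close> and a functional \<open>f\<close>, generate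
  everything. If \<open>im I\<close> is finite-dimensional, take a finite basis \<open>E\<close> of it and functionals
  \<open>f e\<close> on \<open>W\<close> dual to \<open>E\<close>; a map \<open>T\<close> with values in \<open>im I\<close> is the sum of the maps
  \<open>e \<cdot> f e \<circ> T\<close>, and each of them lies in \<open>I\<close> because \<open>e\<close> is a sum of vectors \<open>A x\<close> and
  \<open>(A x) \<cdot> h = A \<circ> (x \<cdot> h)\<close>. If \<open>coim I\<close> is finite-dimensional, the functionals \<open>\<phi> \<circ> A\<close> with
  \<open>A \<in> I\<close> have common kernel \<open>K = ker I\<close>, so a Gram-Schmidt process yields finitely many vectors
  \<open>e\<close>, spanning \<open>V\<close> modulo \<open>K\<close>, and dual functionals \<open>f e\<close> such that \<open>w \<cdot> f e\<close> lies in \<open>I\<close>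
  for all \<open>w\<close>; a map \<open>T\<close> that vanishes on \<open>K\<close> is the sum of the maps \<open>T e \<cdot> f e\<close>.
  A single generator is the sum of the maps \<open>e \<cdot> \<phi> e\<close> (respectively \<open>g e \<cdot> f e\<close>), where the
  vectors \<open>g e\<close> with dual functionals \<open>\<phi> e\<close> belong to the other space; the hypothesis on the
  dimensions provides enough of them.
\<close>

section \<open>Arithmetic, submodules and spans in right modules\<close>

context right_module
begin

lemma a_inv_zero [simp]: "\<ominus>\<^bsub>M\<^esub> \<zero>\<^bsub>M\<^esub> = \<zero>\<^bsub>M\<^esub>"
  by (rule M.minus_equality) auto

lemma rsmult_zero [simp]:
  assumes "x \<in> carrier M"
  shows "x \<cdot>\<^bsub>M\<^esub> \<zero>\<^bsub>R\<^esub> = \<zero>\<^bsub>M\<^esub>"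
proof -
  have "x \<cdot>\<^bsub>M\<^esub> \<zero>\<^bsub>R\<^esub> \<oplus>\<^bsub>M\<^esub> x \<cdot>\<^bsub>M\<^esub> \<zero>\<^bsub>R\<^esub> = x \<cdot>\<^bsub>M\<^esub> \<zero>\<^bsub>R\<^esub>"
    using rsmult_r_distr[OF assms R.zero_closed R.zero_closed] by simp
  then show ?thesis
    using M.add.r_cancel_one assms by blast
qed

lemma zero_rsmult [simp]:
  assumes "a \<in> carrier R"
  shows "\<zero>\<^bsub>M\<^esub> \<cdot>\<^bsub>M\<^esub> a = \<zero>\<^bsub>M\<^esub>"
proof -
  have "\<zero>\<^bsub>M\<^esub> \<cdot>\<^bsub>M\<^esub> a \<oplus>\<^bsub>M\<^esub> \<zero>\<^bsub>M\<^esub> \<cdot>\<^bsub>M\<^esub> a = \<zero>\<^bsub>M\<^esub> \<cdot>\<^bsub>M\<^esub> a"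
    using rsmult_l_distr[OF M.zero_closed M.zero_closed assms] by simp
  then show ?thesis
    using M.add.r_cancel_one assms by blast
qed

lemma rsmult_minus:
  assumes "x \<in> carrier M" "a \<in> carrier R"
  shows "x \<cdot>\<^bsub>M\<^esub> (\<ominus>\<^bsub>R\<^esub> a) = \<ominus>\<^bsub>M\<^esub> (x \<cdot>\<^bsub>M\<^esub> a)"
proof -
  have "x \<cdot>\<^bsub>M\<^esub> (\<ominus>\<^bsub>R\<^esub> a) \<oplus>\<^bsub>M\<^esub> x \<cdot>\<^bsub>M\<^esub> a = \<zero>\<^bsub>M\<^esub>"
    using rsmult_r_distr[of x "\<ominus>\<^bsub>R\<^esub> a" a] assms by (simp add: R.l_neg)
  then show ?thesis
    using M.minus_equality assms by auto
qed

lemma minus_rsmult: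
  assumes "x \<in> carrier M" "a \<in> carrier R"
  shows "(\<ominus>\<^bsub>M\<^esub> x) \<cdot>\<^bsub>M\<^esub> a = \<ominus>\<^bsub>M\<^esub> (x \<cdot>\<^bsub>M\<^esub> a)"
proof -
  have "(\<ominus>\<^bsub>M\<^esub> x) \<cdot>\<^bsub>M\<^esub> a \<oplus>\<^bsub>M\<^esub> x \<cdot>\<^bsub>M\<^esub> a = \<zero>\<^bsub>M\<^esub>"
    using rsmult_l_distr[of "\<ominus>\<^bsub>M\<^esub> x" x a] assms by (simp add: M.l_neg)
  then show ?thesis
    using M.minus_equality assms by auto
qed

text \<open>Closure under negation comes from scalar multiplication, since
  \<open>\<ominus> x\<close> is \<open>x\<close> times \<open>\<ominus> \<one>\<close>.\<close>

lemma right_submoduleI: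
  assumes "H \<subseteq> carrier M" "\<zero>\<^bsub>M\<^esub> \<in> H"
    and "\<And>x y. \<lbrakk>x \<in> H; y \<in> H\<rbrakk> \<Longrightarrow> x \<oplus>\<^bsub>M\<^esub> y \<in> H"
    and smult: "\<And>x a. \<lbrakk>x \<in> H; a \<in> carrier R\<rbrakk> \<Longrightarrow> x \<cdot>\<^bsub>M\<^esub> a \<in> H"
  shows "right_submodule H R M"
proof -
  have "\<ominus>\<^bsub>M\<^esub> x \<in> H" if "x \<in> H" for x
    using smult[OF that, of "\<ominus>\<^bsub>R\<^esub> \<one>\<^bsub>R\<^esub>"] rsmult_minus[of x "\<one>\<^bsub>R\<^esub>"] that assms(1) by auto
  then show ?thesis
    using assms unfolding right_submodule_def right_submodule_axioms_def subgroup_def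
    by (simp add: a_inv_def)
qed

lemma right_submoduleE:
  assumes "right_submodule H R M"
  shows "H \<subseteq> carrier M" "\<zero>\<^bsub>M\<^esub> \<in> H"
    and "\<And>x y. \<lbrakk>x \<in> H; y \<in> H\<rbrakk> \<Longrightarrow> x \<oplus>\<^bsub>M\<^esub> y \<in> H"
    and "\<And>x. x \<in> H \<Longrightarrow> \<ominus>\<^bsub>M\<^esub> x \<in> H"
    and "\<And>x y. \<lbrakk>x \<in> H; y \<in> H\<rbrakk> \<Longrightarrow> x \<ominus>\<^bsub>M\<^esub> y \<in> H"
    and "\<And>x a. \<lbrakk>x \<in> H; a \<in> carrier R\<rbrakk> \<Longrightarrow> x \<cdot>\<^bsub>M\<^esub> a \<in> H"
  using assms unfolding right_submodule_def right_submodule_axioms_def subgroup_def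
  by (simp_all add: a_inv_def a_minus_def)

lemma right_submodule_finsum:
  assumes "right_submodule H R M" "finite F" "g \<in> F \<rightarrow> H"
  shows "(\<Oplus>\<^bsub>M\<^esub>x\<in>F. g x) \<in> H"
  using assms(2,3)
proof (induction F)
  case empty
  then show ?case using right_submoduleE(2)[OF assms(1)] by simp
next
  case (insert x F)
  then have "g \<in> F \<rightarrow> carrier M" "g x \<in> carrier M"
    using right_submoduleE(1)[OF assms(1)] by auto
  then show ?case
    using insert right_submoduleE(3)[OF assms(1)] by (auto simp: M.finsum_insert)
qed

lemma finsum_rsmult:
  assumes "finite F" "g \<in> F \<rightarrow> carrier M" "a \<in> carrier R"
  shows "(\<Oplus>\<^bsub>M\<^esub>x\<in>F. g x) \<cdot>\<^bsub>M\<^esub> a = (\<Oplus>\<^bsub>M\<^esub>x\<in>F. g x \<cdot>\<^bsub>M\<^esub> a)"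
  using assms(1,2)
proof (induction F)
  case empty
  then show ?case using assms(3) by simp
next
  case (insert x F)
  then have "g \<in> F \<rightarrow> carrier M" "g x \<in> carrier M" "(\<lambda>x. g x \<cdot>\<^bsub>M\<^esub> a) \<in> F \<rightarrow> carrier M"
    using assms(3) by auto
  then show ?case
    using insert assms(3) by (simp add: M.finsum_insert rsmult_l_distr)
qed

lemma right_submodule_carrier: "right_submodule (carrier M) R M"
  by (rule right_submoduleI) auto

lemma right_submodule_zero: "right_submodule {\<zero>\<^bsub>M\<^esub>} R M"
  by (rule right_submoduleI) auto

lemma right_span_superset: "S \<subseteq> right_span R M S"
  unfolding right_span_def by (rule hull_subset)

lemma right_span_minimal:
  "\<lbrakk>S \<subseteq> H; right_submodule H R M\<rbrakk> \<Longrightarrow> right_span R M S \<subseteq> H"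
  unfolding right_span_def by (rule hull_minimal)

lemma right_submodule_span:
  assumes "S \<subseteq> carrier M"
  shows "right_submodule (right_span R M S) R M"
proof (rule right_submoduleI)
  show "right_span R M S \<subseteq> carrier M"
    by (rule right_span_minimal[OF assms right_submodule_carrier])
qed (auto simp: right_span_def hull_def dest: right_submoduleE)

text \<open>The span is a hull and so gives no formula for its elements. The finite combinations of
  \<open>S\<close> form a submodule that contains \<open>S\<close>, hence they exhaust the
  hull.\<close>

lemma right_span_finsum:
  assumes S: "S \<subseteq> carrier M" and "x \<in> right_span R M S"
  obtains F u where "finite F" "F \<subseteq> S" "u \<in> F \<rightarrow> carrier R"
    "x = (\<Oplus>\<^bsub>M\<^esub>s\<in>F. s \<cdot>\<^bsub>M\<^esub> u s)"
proof -
  define P where "P = {x. \<exists>F u. finite F \<and> F \<subseteq> S \<and> u \<in> F \<rightarrow> carrier R \<and>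
    x = (\<Oplus>\<^bsub>M\<^esub>s\<in>F. s \<cdot>\<^bsub>M\<^esub> u s)}"
  have PI: "(\<Oplus>\<^bsub>M\<^esub>s\<in>F. s \<cdot>\<^bsub>M\<^esub> u s) \<in> P" if "finite F" "F \<subseteq> S" "u \<in> F \<rightarrow> carrier R" for F u
    using that P_def by blast
  have "right_submodule P R M"
  proof (rule right_submoduleI)
    show "P \<subseteq> carrier M"
      using S by (auto simp: P_def intro!: M.finsum_closed)
    show "\<zero>\<^bsub>M\<^esub> \<in> P"
      using PI[of "{}" "\<lambda>_. \<zero>\<^bsub>R\<^esub>"] by simp
    show "x \<oplus>\<^bsub>M\<^esub> y \<in> P" if x: "x \<in> P" and y: "y \<in> P" for x y
    proof -
      obtain F u where F: "finite F" "F \<subseteq> S" "u \<in> F \<rightarrow> carrier R" "x = (\<Oplus>\<^bsub>M\<^esub>s\<in>F. s \<cdot>\<^bsub>M\<^esub> u s)"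
        using x P_def by auto
      obtain G v where G: "finite G" "G \<subseteq> S" "v \<in> G \<rightarrow> carrier R" "y = (\<Oplus>\<^bsub>M\<^esub>s\<in>G. s \<cdot>\<^bsub>M\<^esub> v s)"
        using y P_def by auto
      \<comment> \<open>Both coefficient families are extended by zero to
        \<open>F \<union> G\<close>, so that the two sums run over the same set and can be added
        termwise.\<close>
      define u' where "u' s = (if s \<in> F then u s else \<zero>\<^bsub>R\<^esub>)" for s
      define v' where "v' s = (if s \<in> G then v s else \<zero>\<^bsub>R\<^esub>)" for s
      have uv: "u' \<in> F \<union> G \<rightarrow> carrier R" "v' \<in> F \<union> G \<rightarrow> carrier R"
        using F G by (auto simp: u'_def v'_def)
      have FG: "F \<union> G \<subseteq> carrier M" using F G S by auto
      have su: "(\<lambda>s. s \<cdot>\<^bsub>M\<^esub> u' s) \<in> F \<union> G \<rightarrow> carrier M" "(\<lambda>s. s \<cdot>\<^bsub>M\<^esub> v' s) \<in> F \<union> G \<rightarrow> carrier M"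
        using FG uv by auto
      have "x = (\<Oplus>\<^bsub>M\<^esub>s\<in>F \<union> G. s \<cdot>\<^bsub>M\<^esub> u' s)"
        unfolding F(4) using F G FG su
        by (intro M.add.finprod_mono_neutral_cong_left) (auto simp: u'_def)
      moreover have "y = (\<Oplus>\<^bsub>M\<^esub>s\<in>F \<union> G. s \<cdot>\<^bsub>M\<^esub> v' s)"
        unfolding G(4) using F G FG su
        by (intro M.add.finprod_mono_neutral_cong_left) (auto simp: v'_def)
      ultimately have "x \<oplus>\<^bsub>M\<^esub> y = (\<Oplus>\<^bsub>M\<^esub>s\<in>F \<union> G. s \<cdot>\<^bsub>M\<^esub> u' s \<oplus>\<^bsub>M\<^esub> s \<cdot>\<^bsub>M\<^esub> v' s)"
        using M.finsum_addf[OF su] by simp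
      also have "\<dots> = (\<Oplus>\<^bsub>M\<^esub>s\<in>F \<union> G. s \<cdot>\<^bsub>M\<^esub> (u' s \<oplus>\<^bsub>R\<^esub> v' s))"
        using FG uv by (intro M.finsum_cong') (auto simp: rsmult_r_distr Pi_iff subset_eq)
      also have "\<dots> \<in> P"
        using uv F G by (intro PI) auto
      finally show ?thesis .
    qed
    show "x \<cdot>\<^bsub>M\<^esub> a \<in> P" if x: "x \<in> P" and a: "a \<in> carrier R" for x a
    proof -
      obtain F u where F: "finite F" "F \<subseteq> S" "u \<in> F \<rightarrow> carrier R" "x = (\<Oplus>\<^bsub>M\<^esub>s\<in>F. s \<cdot>\<^bsub>M\<^esub> u s)"
        using x P_def by auto
      have "x \<cdot>\<^bsub>M\<^esub> a = (\<Oplus>\<^bsub>M\<^esub>s\<in>F. (s \<cdot>\<^bsub>M\<^esub> u s) \<cdot>\<^bsub>M\<^esub> a)"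
        unfolding F(4) using F S a by (intro finsum_rsmult) auto
      also have "\<dots> = (\<Oplus>\<^bsub>M\<^esub>s\<in>F. s \<cdot>\<^bsub>M\<^esub> (u s \<otimes>\<^bsub>R\<^esub> a))"
        using F S a by (intro M.finsum_cong') (auto simp: rsmult_assoc Pi_iff subset_eq)
      also have "\<dots> \<in> P"
        using F a by (intro PI) auto
      finally show ?thesis .
    qed
  qed
  moreover have "S \<subseteq> P"
  proof
    fix s assume s: "s \<in> S"
    then show "s \<in> P"
      using PI[of "{s}" "\<lambda>_. \<one>\<^bsub>R\<^esub>"] S by (auto simp: M.finsum_insert)
  qed
  ultimately have "x \<in> P"
    using assms(2) right_span_minimal by blast
  then show thesis
    using that P_def by auto
qed

end

section \<open>Functionals, bases and coordinates\<close>

definition functional :: "('d, 'm) ring_scheme \<Rightarrow> ('d, 'v, 'n) right_module_scheme \<Rightarrow> ('v \<Rightarrow> 'd) \<Rightarrow> bool"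
  where "functional D V f \<longleftrightarrow> f \<in> carrier V \<rightarrow> carrier D \<and>
    (\<forall>x\<in>carrier V. \<forall>y\<in>carrier V. f (x \<oplus>\<^bsub>V\<^esub> y) = f x \<oplus>\<^bsub>D\<^esub> f y) \<and>
    (\<forall>x\<in>carrier V. \<forall>a\<in>carrier D. f (x \<cdot>\<^bsub>V\<^esub> a) = f x \<otimes>\<^bsub>D\<^esub> a)"

text \<open>Each functional is indexed by the vector to which it is dual, and it is defined on the
  whole space rather than on the span of \<open>E\<close>. Biorthogonality makes \<open>E\<close>
  independent.\<close>

definition dual_basis ::
  "('d, 'm) ring_scheme \<Rightarrow> ('d, 'v, 'n) right_module_scheme \<Rightarrow> 'v set \<Rightarrow> ('v \<Rightarrow> 'v \<Rightarrow> 'd) \<Rightarrow> bool"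
  where "dual_basis D V E f \<longleftrightarrow> finite E \<and> E \<subseteq> carrier V \<and>
    (\<forall>e\<in>E. functional D V (f e) \<and>
      (\<forall>e'\<in>E. f e e' = (if e = e' then \<one>\<^bsub>D\<^esub> else \<zero>\<^bsub>D\<^esub>)))"

context right_vector_space
begin

lemma one_neq_zero: "\<one>\<^bsub>D\<^esub> \<noteq> \<zero>\<^bsub>D\<^esub>"
  using skew_field_Units R.Units_one_closed by auto

lemma left_inverse:
  assumes "a \<in> carrier D" "a \<noteq> \<zero>\<^bsub>D\<^esub>"
  obtains b where "b \<in> carrier D" "b \<otimes>\<^bsub>D\<^esub> a = \<one>\<^bsub>D\<^esub>" "a \<otimes>\<^bsub>D\<^esub> b = \<one>\<^bsub>D\<^esub>"
proof -
  have "a \<in> Units D" using assms skew_field_Units by auto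
  then show thesis
    using that R.Units_inv_closed R.Units_l_inv R.Units_r_inv by blast
qed

lemma functional_closed: "\<lbrakk>functional D V f; x \<in> carrier V\<rbrakk> \<Longrightarrow> f x \<in> carrier D"
  by (auto simp: functional_def)

lemma functional_add:
  "\<lbrakk>functional D V f; x \<in> carrier V; y \<in> carrier V\<rbrakk> \<Longrightarrow> f (x \<oplus>\<^bsub>V\<^esub> y) = f x \<oplus>\<^bsub>D\<^esub> f y"
  by (auto simp: functional_def)

lemma functional_rsmult:
  "\<lbrakk>functional D V f; x \<in> carrier V; a \<in> carrier D\<rbrakk> \<Longrightarrow> f (x \<cdot>\<^bsub>V\<^esub> a) = f x \<otimes>\<^bsub>D\<^esub> a"
  by (auto simp: functional_def)

lemma functional_zero: "functional D V f \<Longrightarrow> f \<zero>\<^bsub>V\<^esub> = \<zero>\<^bsub>D\<^esub>"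
  using functional_rsmult[of f "\<zero>\<^bsub>V\<^esub>" "\<zero>\<^bsub>D\<^esub>"] functional_closed[of f "\<zero>\<^bsub>V\<^esub>"] by simp

lemma functional_minus:
  assumes f: "functional D V f" and x: "x \<in> carrier V"
  shows "f (\<ominus>\<^bsub>V\<^esub> x) = \<ominus>\<^bsub>D\<^esub> f x"
proof -
  have "f (\<ominus>\<^bsub>V\<^esub> x) \<oplus>\<^bsub>D\<^esub> f x = \<zero>\<^bsub>D\<^esub>"
    using functional_add[OF f, of "\<ominus>\<^bsub>V\<^esub> x" x] functional_zero[OF f] x by (simp add: M.l_neg)
  then show ?thesis
    using R.minus_equality f x functional_closed by (metis M.a_inv_closed)
qed

lemma functional_diff:
  "\<lbrakk>functional D V f; x \<in> carrier V; y \<in> carrier V\<rbrakk> \<Longrightarrow> f (x \<ominus>\<^bsub>V\<^esub> y) = f x \<ominus>\<^bsub>D\<^esub> f y"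
  by (simp add: a_minus_def functional_add functional_minus)

lemma functional_finsum:
  assumes f: "functional D V f" and "finite E" "g \<in> E \<rightarrow> carrier V"
  shows "f (\<Oplus>\<^bsub>V\<^esub>e\<in>E. g e) = (\<Oplus>\<^bsub>D\<^esub>e\<in>E. f (g e))"
  using assms(2,3)
proof (induction E)
  case empty
  then show ?case using functional_zero[OF f] by simp
next
  case (insert x F)
  then have "g \<in> F \<rightarrow> carrier V" "g x \<in> carrier V" "(\<lambda>x. f (g x)) \<in> F \<rightarrow> carrier D"
    "f (g x) \<in> carrier D"
    using functional_closed[OF f] by auto
  then show ?case
    using insert by (simp add: M.finsum_insert R.finsum_insert functional_add[OF f])
qed

text \<open>Functionals on a right space form a left space, so scalars act on them from the left.
  This difference is the operation from which residual functionals are built in the Gram-Schmidt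
  process.\<close>

lemma functional_lmult_diff:
  assumes f: "functional D V f" and g: "functional D V g" and a: "a \<in> carrier D"
  shows "functional D V (\<lambda>x. f x \<ominus>\<^bsub>D\<^esub> a \<otimes>\<^bsub>D\<^esub> g x)"
  unfolding functional_def
proof (intro conjI ballI)
  show "(\<lambda>x. f x \<ominus>\<^bsub>D\<^esub> a \<otimes>\<^bsub>D\<^esub> g x) \<in> carrier V \<rightarrow> carrier D"
    using f g a by (auto simp: functional_closed)
  fix x assume x: "x \<in> carrier V"
  note fg = functional_closed[OF f x] functional_closed[OF g x]
  show "f (x \<oplus>\<^bsub>V\<^esub> y) \<ominus>\<^bsub>D\<^esub> a \<otimes>\<^bsub>D\<^esub> g (x \<oplus>\<^bsub>V\<^esub> y) =
      f x \<ominus>\<^bsub>D\<^esub> a \<otimes>\<^bsub>D\<^esub> g x \<oplus>\<^bsub>D\<^esub> (f y \<ominus>\<^bsub>D\<^esub> a \<otimes>\<^bsub>D\<^esub> g y)" if y: "y \<in> carrier V" for y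
    using fg functional_closed[OF f y] functional_closed[OF g y] a x y
    by (simp add: functional_add[OF f] functional_add[OF g] a_minus_def R.r_distr R.minus_add R.a_ac)
  show "f (x \<cdot>\<^bsub>V\<^esub> b) \<ominus>\<^bsub>D\<^esub> a \<otimes>\<^bsub>D\<^esub> g (x \<cdot>\<^bsub>V\<^esub> b) = (f x \<ominus>\<^bsub>D\<^esub> a \<otimes>\<^bsub>D\<^esub> g x) \<otimes>\<^bsub>D\<^esub> b"
    if b: "b \<in> carrier D" for b
    using fg a b x
    by (simp add: functional_rsmult[OF f] functional_rsmult[OF g] a_minus_def R.l_distr R.l_minus R.m_assoc)
qed

lemma functional_lmult:
  assumes f: "functional D V f" and a: "a \<in> carrier D"
  shows "functional D V (\<lambda>x. a \<otimes>\<^bsub>D\<^esub> f x)"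
  using assms unfolding functional_def by (auto simp: R.r_distr R.m_assoc Pi_iff)

text \<open>Zorn's lemma gives a maximal independent set. It spans, because a vector outside its
  span could be added to it without losing independence.\<close>

lemma basis_exists: "\<exists>B. is_basis D V B"
proof -
  define \<A> where "\<A> = {B. B \<subseteq> carrier V \<and> lin_indep D V B}"
  have "{} \<in> \<A>" by (auto simp: \<A>_def lin_indep_def)
  have "\<exists>B\<in>\<A>. \<forall>X\<in>\<A>. B \<subseteq> X \<longrightarrow> X = B"
  proof (rule subset_Zorn_nonempty)
    show "\<A> \<noteq> {}" using \<open>{} \<in> \<A>\<close> by auto
    fix \<C> assume \<C>: "\<C> \<noteq> {}" "subset.chain \<A> \<C>"
    then have sub: "\<C> \<subseteq> \<A>" by (simp add: subset_chain_def)
    \<comment> \<open>Independence concerns finite subsets only, and a finite subset of the union of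
      a chain lies in one member of the chain.\<close>
    have "\<forall>x\<in>F. u x = \<zero>\<^bsub>D\<^esub>" if F: "finite F" "F \<subseteq> \<Union>\<C>" "u \<in> F \<rightarrow> carrier D"
        "(\<Oplus>\<^bsub>V\<^esub>x\<in>F. x \<cdot>\<^bsub>V\<^esub> u x) = \<zero>\<^bsub>V\<^esub>" for F u
    proof -
      obtain B where "B \<in> \<C>" "F \<subseteq> B"
        using finite_subset_Union_chain[OF F(1,2) \<C>] by blast
      then have "lin_indep D V B" using sub by (auto simp: \<A>_def)
      then show ?thesis using F \<open>F \<subseteq> B\<close> unfolding lin_indep_def by blast
    qed
    then have "lin_indep D V (\<Union>\<C>)" unfolding lin_indep_def by blast
    then show "\<Union>\<C> \<in> \<A>" using sub by (auto simp: \<A>_def)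
  qed
  then obtain B where B: "B \<subseteq> carrier V" "lin_indep D V B"
    and max: "\<And>X. \<lbrakk>X \<subseteq> carrier V; lin_indep D V X; B \<subseteq> X\<rbrakk> \<Longrightarrow> X = B"
    unfolding \<A>_def by auto
  note span = right_submodule_span[OF B(1)]
  have "x \<in> right_span D V B" if x: "x \<in> carrier V" for x
  proof (rule ccontr)
    assume nx: "x \<notin> right_span D V B"
    have "\<forall>y\<in>F. u y = \<zero>\<^bsub>D\<^esub>" if F: "finite F" "F \<subseteq> insert x B" "u \<in> F \<rightarrow> carrier D"
        "(\<Oplus>\<^bsub>V\<^esub>y\<in>F. y \<cdot>\<^bsub>V\<^esub> u y) = \<zero>\<^bsub>V\<^esub>" for F u
    proof (cases "x \<in> F")
      case False
      then have "F \<subseteq> B" using F by auto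
      then show ?thesis using B(2) F unfolding lin_indep_def by blast
    next
      case True
      define G where "G = F - {x}"
      have G: "finite G" "G \<subseteq> B" "x \<notin> G" "F = insert x G"
        using F True by (auto simp: G_def)
      define s where "s = (\<Oplus>\<^bsub>V\<^esub>y\<in>G. y \<cdot>\<^bsub>V\<^esub> u y)"
      have ux: "u x \<in> carrier D" and uG: "u \<in> G \<rightarrow> carrier D" using F G by auto
      have GV: "(\<lambda>y. y \<cdot>\<^bsub>V\<^esub> u y) \<in> G \<rightarrow> carrier V" using uG G(2) B(1) by auto
      have s_span: "s \<in> right_span D V B" unfolding s_def
        using uG G right_span_superset[of B]
        by (intro right_submodule_finsum[OF span]) (auto intro!: right_submoduleE(6)[OF span])
      have sV: "s \<in> carrier V" using s_span right_submoduleE(1)[OF span] by auto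
      have sum: "x \<cdot>\<^bsub>V\<^esub> u x \<oplus>\<^bsub>V\<^esub> s = \<zero>\<^bsub>V\<^esub>"
        using F(4) G GV x ux unfolding s_def by (simp add: M.finsum_insert)
      \<comment> \<open>A nonzero coefficient of \<open>x\<close> is invertible, so the relation
        could be solved for \<open>x\<close>, which would place \<open>x\<close> in the span of
        \<open>B\<close>.\<close>
      have "u x = \<zero>\<^bsub>D\<^esub>"
      proof (rule ccontr)
        assume "u x \<noteq> \<zero>\<^bsub>D\<^esub>"
        then obtain c where c: "c \<in> carrier D" "u x \<otimes>\<^bsub>D\<^esub> c = \<one>\<^bsub>D\<^esub>"
          using left_inverse ux by metis
        have "x \<cdot>\<^bsub>V\<^esub> u x = \<ominus>\<^bsub>V\<^esub> s"
          using M.minus_equality[OF sum sV] x ux by simp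
        then have "x \<cdot>\<^bsub>V\<^esub> u x \<in> right_span D V B"
          using right_submoduleE(4)[OF span s_span] by simp
        then have "(x \<cdot>\<^bsub>V\<^esub> u x) \<cdot>\<^bsub>V\<^esub> c \<in> right_span D V B"
          using right_submoduleE(6)[OF span] c by blast
        then show False
          using nx c x ux by (simp flip: rsmult_assoc)
      qed
      moreover from this have "s = \<zero>\<^bsub>V\<^esub>" using sum x sV by simp
      then have "\<forall>y\<in>G. u y = \<zero>\<^bsub>D\<^esub>"
        using B(2) G uG unfolding lin_indep_def s_def by blast
      ultimately show ?thesis using G by auto
    qed
    then have "lin_indep D V (insert x B)" unfolding lin_indep_def by blast
    then have "insert x B = B" using max[of "insert x B"] B x by auto
    then show False using nx right_span_superset[of B] by auto
  qed
  then have "is_basis D V B"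
    using B right_submoduleE(1)[OF span] unfolding is_basis_def by auto
  then show ?thesis ..
qed

text \<open>The space is the direct sum of the line through \<open>b\<close> and the span
  \<open>H\<close> of the other basis vectors. The functional is the coefficient of the first
  component.\<close>

lemma coordinate_exists:
  assumes B: "is_basis D V B" and b: "b \<in> B"
  obtains f where "functional D V f" "f b = \<one>\<^bsub>D\<^esub>" "\<And>b'. \<lbrakk>b' \<in> B; b' \<noteq> b\<rbrakk> \<Longrightarrow> f b' = \<zero>\<^bsub>D\<^esub>"
proof -
  define H where "H = right_span D V (B - {b})"
  have BV: "B \<subseteq> carrier V" and bV: "b \<in> carrier V" using B b unfolding is_basis_def by auto
  have H: "right_submodule H D V"
    unfolding H_def using BV by (intro right_submodule_span) auto
  note HE = right_submoduleE[OF H]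
  \<comment> \<open>The line through \<open>b\<close> meets \<open>H\<close> only in zero; this is
    what makes the coefficient unique.\<close>
  have indep: "d = \<zero>\<^bsub>D\<^esub>" if d: "d \<in> carrier D" "b \<cdot>\<^bsub>V\<^esub> d \<in> H" for d
  proof -
    obtain F u where F: "finite F" "F \<subseteq> B - {b}" "u \<in> F \<rightarrow> carrier D"
        "b \<cdot>\<^bsub>V\<^esub> d = (\<Oplus>\<^bsub>V\<^esub>s\<in>F. s \<cdot>\<^bsub>V\<^esub> u s)"
      using right_span_finsum[of "B - {b}" "b \<cdot>\<^bsub>V\<^esub> d"] d BV unfolding H_def by blast
    \<comment> \<open>Moving \<open>b \<cdot> d\<close> to the other side turns the expansion into a
      relation on \<open>insert b F\<close> with coefficient \<open>\<ominus> d\<close> at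
      \<open>b\<close>; independence then kills \<open>d\<close>.\<close>
    define u' where "u' = u(b := \<ominus>\<^bsub>D\<^esub> d)"
    have FV: "(\<lambda>s. s \<cdot>\<^bsub>V\<^esub> u s) \<in> F \<rightarrow> carrier V" using F BV by auto
    have "(\<Oplus>\<^bsub>V\<^esub>s\<in>F. s \<cdot>\<^bsub>V\<^esub> u' s) = (\<Oplus>\<^bsub>V\<^esub>s\<in>F. s \<cdot>\<^bsub>V\<^esub> u s)"
      using F FV by (intro M.finsum_cong') (auto simp: u'_def)
    then have "(\<Oplus>\<^bsub>V\<^esub>s\<in>insert b F. s \<cdot>\<^bsub>V\<^esub> u' s) = b \<cdot>\<^bsub>V\<^esub> (\<ominus>\<^bsub>D\<^esub> d) \<oplus>\<^bsub>V\<^esub> b \<cdot>\<^bsub>V\<^esub> d"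
      using F FV bV d by (subst M.finsum_insert) (auto simp: u'_def)
    also have "\<dots> = \<zero>\<^bsub>V\<^esub>" using bV d by (simp add: rsmult_minus M.l_neg)
    finally have "u' b = \<zero>\<^bsub>D\<^esub>"
      using B b F d unfolding is_basis_def lin_indep_def
      by (auto simp: u'_def dest!: spec[of _ "insert b F"] spec[of _ u'])
    then show ?thesis using d unfolding u'_def by simp
  qed
  define f where "f x = (THE d. d \<in> carrier D \<and> x \<ominus>\<^bsub>V\<^esub> b \<cdot>\<^bsub>V\<^esub> d \<in> H)" for x
  have f_eq: "f x = d" if x: "x \<in> carrier V" and d: "d \<in> carrier D" "x \<ominus>\<^bsub>V\<^esub> b \<cdot>\<^bsub>V\<^esub> d \<in> H" for x d
    unfolding f_def
  proof (rule the_equality)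
    show "d \<in> carrier D \<and> x \<ominus>\<^bsub>V\<^esub> b \<cdot>\<^bsub>V\<^esub> d \<in> H" using d by simp
    fix d' assume d': "d' \<in> carrier D \<and> x \<ominus>\<^bsub>V\<^esub> b \<cdot>\<^bsub>V\<^esub> d' \<in> H"
    have "(x \<ominus>\<^bsub>V\<^esub> b \<cdot>\<^bsub>V\<^esub> d) \<ominus>\<^bsub>V\<^esub> (x \<ominus>\<^bsub>V\<^esub> b \<cdot>\<^bsub>V\<^esub> d') = b \<cdot>\<^bsub>V\<^esub> (d' \<ominus>\<^bsub>D\<^esub> d)"
      using x d d' bV
      by (simp add: a_minus_def rsmult_r_distr rsmult_minus M.minus_add M.a_ac M.r_neg1 M.r_neg2)
    then have "d' \<ominus>\<^bsub>D\<^esub> d = \<zero>\<^bsub>D\<^esub>"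
      using indep[of "d' \<ominus>\<^bsub>D\<^esub> d"] HE(5) d d' by (metis R.minus_closed)
    then show "d' = d" using R.minus_equality[of d' "\<ominus>\<^bsub>D\<^esub> d"] d d' by (simp add: R.minus_eq)
  qed
  \<comment> \<open>Existence of the coefficient: the vectors that have one form a subspace
    containing \<open>B\<close>, hence everything. The facts \<open>add\<close> and
    \<open>smult\<close> serve both this and the linearity of \<open>f\<close>.\<close>
  define P where "P = {x \<in> carrier V. \<exists>d\<in>carrier D. x \<ominus>\<^bsub>V\<^esub> b \<cdot>\<^bsub>V\<^esub> d \<in> H}"
  have add: "(x \<oplus>\<^bsub>V\<^esub> y) \<ominus>\<^bsub>V\<^esub> b \<cdot>\<^bsub>V\<^esub> (d \<oplus>\<^bsub>D\<^esub> d') \<in> H"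
    if "x \<in> carrier V" "y \<in> carrier V" "d \<in> carrier D" "d' \<in> carrier D"
      "x \<ominus>\<^bsub>V\<^esub> b \<cdot>\<^bsub>V\<^esub> d \<in> H" "y \<ominus>\<^bsub>V\<^esub> b \<cdot>\<^bsub>V\<^esub> d' \<in> H" for x y d d'
  proof -
    have "(x \<oplus>\<^bsub>V\<^esub> y) \<ominus>\<^bsub>V\<^esub> b \<cdot>\<^bsub>V\<^esub> (d \<oplus>\<^bsub>D\<^esub> d') = (x \<ominus>\<^bsub>V\<^esub> b \<cdot>\<^bsub>V\<^esub> d) \<oplus>\<^bsub>V\<^esub> (y \<ominus>\<^bsub>V\<^esub> b \<cdot>\<^bsub>V\<^esub> d')"
      using that bV by (simp add: a_minus_def rsmult_r_distr M.minus_add M.a_ac)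
    then show ?thesis using HE(3) that by simp
  qed
  have smult: "(x \<cdot>\<^bsub>V\<^esub> a) \<ominus>\<^bsub>V\<^esub> b \<cdot>\<^bsub>V\<^esub> (d \<otimes>\<^bsub>D\<^esub> a) \<in> H"
    if "x \<in> carrier V" "d \<in> carrier D" "a \<in> carrier D" "x \<ominus>\<^bsub>V\<^esub> b \<cdot>\<^bsub>V\<^esub> d \<in> H" for x d a
  proof -
    have "(x \<cdot>\<^bsub>V\<^esub> a) \<ominus>\<^bsub>V\<^esub> b \<cdot>\<^bsub>V\<^esub> (d \<otimes>\<^bsub>D\<^esub> a) = (x \<ominus>\<^bsub>V\<^esub> b \<cdot>\<^bsub>V\<^esub> d) \<cdot>\<^bsub>V\<^esub> a"
      using that bV
      by (simp add: a_minus_def rsmult_l_distr minus_rsmult rsmult_assoc)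
    then show ?thesis using HE(6) that by simp
  qed
  have base: "b' \<ominus>\<^bsub>V\<^esub> b \<cdot>\<^bsub>V\<^esub> (if b' = b then \<one>\<^bsub>D\<^esub> else \<zero>\<^bsub>D\<^esub>) \<in> H" if "b' \<in> B" for b'
  proof -
    have "b' \<in> H" if "b' \<noteq> b"
      using that \<open>b' \<in> B\<close> right_span_superset[of "B - {b}"] unfolding H_def by auto
    then show ?thesis using that BV bV HE(2) by (auto simp: M.minus_eq M.r_neg subset_eq)
  qed
  have "right_submodule P D V"
  proof (rule right_submoduleI)
    show "\<zero>\<^bsub>V\<^esub> \<in> P" using HE(2) bV unfolding P_def
      by (auto intro!: bexI[of _ "\<zero>\<^bsub>D\<^esub>"] simp: M.minus_eq)
    show "x \<oplus>\<^bsub>V\<^esub> y \<in> P" if xy: "x \<in> P" "y \<in> P" for x y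
    proof -
      obtain d d' where "d \<in> carrier D" "x \<ominus>\<^bsub>V\<^esub> b \<cdot>\<^bsub>V\<^esub> d \<in> H"
          "d' \<in> carrier D" "y \<ominus>\<^bsub>V\<^esub> b \<cdot>\<^bsub>V\<^esub> d' \<in> H"
        using xy unfolding P_def by auto
      then show ?thesis
        using add[of x y d d'] xy unfolding P_def by (auto intro!: bexI[of _ "d \<oplus>\<^bsub>D\<^esub> d'"])
    qed
    show "x \<cdot>\<^bsub>V\<^esub> a \<in> P" if xa: "x \<in> P" "a \<in> carrier D" for x a
    proof -
      obtain d where "d \<in> carrier D" "x \<ominus>\<^bsub>V\<^esub> b \<cdot>\<^bsub>V\<^esub> d \<in> H"
        using xa unfolding P_def by auto
      then show ?thesis
        using smult[of x d a] xa unfolding P_def by (auto intro!: bexI[of _ "d \<otimes>\<^bsub>D\<^esub> a"])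
    qed
  qed (auto simp: P_def)
  moreover have "B \<subseteq> P"
  proof
    fix b' assume b': "b' \<in> B"
    show "b' \<in> P" unfolding P_def
      using base[OF b'] b' BV
      by (auto intro!: bexI[of _ "if b' = b then \<one>\<^bsub>D\<^esub> else \<zero>\<^bsub>D\<^esub>"])
  qed
  ultimately have PV: "P = carrier V"
    using right_span_minimal[of B P] B unfolding is_basis_def P_def by auto
  have f_mem: "f x \<in> carrier D" "x \<ominus>\<^bsub>V\<^esub> b \<cdot>\<^bsub>V\<^esub> f x \<in> H" if x: "x \<in> carrier V" for x
  proof -
    obtain d where "d \<in> carrier D" "x \<ominus>\<^bsub>V\<^esub> b \<cdot>\<^bsub>V\<^esub> d \<in> H" using x PV P_def by auto
    then show "f x \<in> carrier D" "x \<ominus>\<^bsub>V\<^esub> b \<cdot>\<^bsub>V\<^esub> f x \<in> H" using f_eq[OF x] by auto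
  qed
  have "functional D V f"
    unfolding functional_def
    using f_mem f_eq add smult by (auto simp: Pi_iff)
  moreover have "f b' = (if b' = b then \<one>\<^bsub>D\<^esub> else \<zero>\<^bsub>D\<^esub>)" if "b' \<in> B" for b'
    using f_eq base[OF that] that BV by auto
  ultimately show thesis using that b by simp
qed

lemma basis_dual_basis:
  assumes B: "is_basis D V B" and E: "finite E" "E \<subseteq> B"
  obtains f where "dual_basis D V E f"
proof -
  have "\<exists>f. functional D V f \<and> f b = \<one>\<^bsub>D\<^esub> \<and> (\<forall>b'\<in>B. b' \<noteq> b \<longrightarrow> f b' = \<zero>\<^bsub>D\<^esub>)" if "b \<in> B" for b
    using coordinate_exists[OF B that] by metis
  then obtain f where
    "\<And>b. b \<in> B \<Longrightarrow> functional D V (f b) \<and> f b b = \<one>\<^bsub>D\<^esub> \<and> (\<forall>b'\<in>B. b' \<noteq> b \<longrightarrow> f b b' = \<zero>\<^bsub>D\<^esub>)"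
    by metis
  moreover have "B \<subseteq> carrier V" using B unfolding is_basis_def by simp
  ultimately have "dual_basis D V E f"
    using E unfolding dual_basis_def by (auto simp: subset_eq)
  then show thesis by (rule that)
qed

text \<open>In an expansion of a nonzero vector over a basis some coefficient is nonzero, and the
  coordinate functional of that basis vector returns it.\<close>

lemma functional_separates:
  assumes x: "x \<in> carrier V" "x \<noteq> \<zero>\<^bsub>V\<^esub>"
  obtains f where "functional D V f" "f x \<noteq> \<zero>\<^bsub>D\<^esub>"
proof -
  obtain B where B: "is_basis D V B" using basis_exists ..
  then have BV: "B \<subseteq> carrier V" and "x \<in> right_span D V B"
    using x unfolding is_basis_def by auto
  then obtain F u where F: "finite F" "F \<subseteq> B" "u \<in> F \<rightarrow> carrier D"
      "x = (\<Oplus>\<^bsub>V\<^esub>s\<in>F. s \<cdot>\<^bsub>V\<^esub> u s)"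
    using right_span_finsum by metis
  obtain f where f: "dual_basis D V F f" using basis_dual_basis[OF B F(1,2)] .
  have sV: "(\<lambda>s. s \<cdot>\<^bsub>V\<^esub> u s) \<in> F \<rightarrow> carrier V" using F BV by auto
  obtain b where b: "b \<in> F" "u b \<noteq> \<zero>\<^bsub>D\<^esub>"
  proof (rule ccontr)
    assume "\<not> thesis"
    then have "\<And>s. s \<in> F \<Longrightarrow> u s = \<zero>\<^bsub>D\<^esub>" using that by blast
    then have "(\<Oplus>\<^bsub>V\<^esub>s\<in>F. s \<cdot>\<^bsub>V\<^esub> u s) = (\<Oplus>\<^bsub>V\<^esub>s\<in>F. \<zero>\<^bsub>V\<^esub>)"
      using F BV by (intro M.finsum_cong') auto
    then show False using x F(4) by simp
  qed
  have fb: "functional D V (f b)" using f b unfolding dual_basis_def by blast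
  have "f b x = (\<Oplus>\<^bsub>D\<^esub>s\<in>F. f b (s \<cdot>\<^bsub>V\<^esub> u s))"
    unfolding F(4) by (rule functional_finsum[OF fb F(1) sV])
  also have "\<dots> = (\<Oplus>\<^bsub>D\<^esub>s\<in>F. if b = s then u s else \<zero>\<^bsub>D\<^esub>)"
  proof (rule R.finsum_cong')
    fix s assume s: "s \<in> F"
    then have "f b (s \<cdot>\<^bsub>V\<^esub> u s) = f b s \<otimes>\<^bsub>D\<^esub> u s" using functional_rsmult[OF fb] F BV by blast
    moreover have "f b s = (if b = s then \<one>\<^bsub>D\<^esub> else \<zero>\<^bsub>D\<^esub>)"
      using f b s unfolding dual_basis_def by blast
    moreover have "u s \<in> carrier D" using F s by auto
    ultimately show "f b (s \<cdot>\<^bsub>V\<^esub> u s) = (if b = s then u s else \<zero>\<^bsub>D\<^esub>)" by simp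
  qed (use F in auto)
  also have "\<dots> = u b" using b F by (intro R.finsum_singleton) auto
  finally show thesis using that fb b by simp
qed

end

section \<open>Linear maps and finite sums of rank-one maps\<close>

locale right_vector_space_pair =
  V: right_vector_space D V + W: right_vector_space D W
  for D :: "('d, 'm) ring_scheme" and V :: "('d, 'v, 'n) right_module_scheme"
    and W :: "('d, 'w, 'k) right_module_scheme"

text \<open>The finite-rank map that is the sum of the tensors of \<open>w e\<close> with
  \<open>f e\<close>. The index type is free, so that vectors of one space can be paired with
  functionals indexed by vectors of another.\<close>

definition lin_comb ::
  "('d, 'v, 'n) right_module_scheme \<Rightarrow> ('d, 'w, 'k) right_module_scheme \<Rightarrow> 'e set
    \<Rightarrow> ('e \<Rightarrow> 'w) \<Rightarrow> ('e \<Rightarrow> 'v \<Rightarrow> 'd) \<Rightarrow> 'v \<Rightarrow> 'w"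
  where "lin_comb V W E w f = (\<lambda>x\<in>carrier V. \<Oplus>\<^bsub>W\<^esub>e\<in>E. w e \<cdot>\<^bsub>W\<^esub> f e x)"

lemma lin_mapsE:
  assumes "T \<in> lin_maps D V W"
  shows "T \<in> extensional (carrier V)"
    and "\<And>x. x \<in> carrier V \<Longrightarrow> T x \<in> carrier W"
    and "\<And>x y. \<lbrakk>x \<in> carrier V; y \<in> carrier V\<rbrakk> \<Longrightarrow> T (x \<oplus>\<^bsub>V\<^esub> y) = T x \<oplus>\<^bsub>W\<^esub> T y"
    and "\<And>x a. \<lbrakk>x \<in> carrier V; a \<in> carrier D\<rbrakk> \<Longrightarrow> T (x \<cdot>\<^bsub>V\<^esub> a) = T x \<cdot>\<^bsub>W\<^esub> a"
  using assms unfolding lin_maps_def by (auto simp: PiE_def)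

text \<open>Functionals are bare functions with no prescribed value off the carrier, unlike linear
  maps; hence the composition is written without \<open>compose\<close>.\<close>

lemma functional_comp:
  assumes "T \<in> lin_maps D V W" "functional D W f"
  shows "functional D V (\<lambda>x. f (T x))"
  using assms(2) lin_mapsE[OF assms(1)] unfolding functional_def by (auto simp: Pi_iff)

context right_vector_space_pair
begin

lemma lin_maps_zero:
  assumes T: "T \<in> lin_maps D V W"
  shows "T \<zero>\<^bsub>V\<^esub> = \<zero>\<^bsub>W\<^esub>"
  using lin_mapsE(4)[OF T V.M.zero_closed V.R.zero_closed] lin_mapsE(2)[OF T V.M.zero_closed] by simp

lemma lin_maps_minus:
  assumes T: "T \<in> lin_maps D V W" and x: "x \<in> carrier V"
  shows "T (\<ominus>\<^bsub>V\<^esub> x) = \<ominus>\<^bsub>W\<^esub> T x"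
  using lin_mapsE(4)[OF T x, of "\<ominus>\<^bsub>D\<^esub> \<one>\<^bsub>D\<^esub>"] lin_mapsE(2)[OF T x] x
  by (simp add: V.rsmult_minus W.rsmult_minus)

lemma lin_maps_finsum:
  assumes T: "T \<in> lin_maps D V W" and "finite E" "g \<in> E \<rightarrow> carrier V"
  shows "T (\<Oplus>\<^bsub>V\<^esub>e\<in>E. g e) = (\<Oplus>\<^bsub>W\<^esub>e\<in>E. T (g e))"
  using assms(2,3)
proof (induction E)
  case empty
  then show ?case using lin_maps_zero[OF T] by simp
next
  case (insert x F)
  then have "g \<in> F \<rightarrow> carrier V" "g x \<in> carrier V" "(\<lambda>x. T (g x)) \<in> F \<rightarrow> carrier W"
    "T (g x) \<in> carrier W"
    using lin_mapsE(2)[OF T] by auto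
  then show ?case
    using insert by (simp add: V.M.finsum_insert W.M.finsum_insert lin_mapsE(3)[OF T])
qed

lemma lin_maps_preimage_submodule:
  assumes T: "T \<in> lin_maps D V W" and H: "right_submodule H D W"
  shows "right_submodule {x \<in> carrier V. T x \<in> H} D V"
  by (rule V.right_submoduleI)
    (auto simp: lin_mapsE[OF T] lin_maps_zero[OF T] W.right_submoduleE[OF H])

lemma rsmult_functional_lin_maps:
  assumes w: "w \<in> carrier W" and f: "functional D V f"
  shows "(\<lambda>x\<in>carrier V. w \<cdot>\<^bsub>W\<^esub> f x) \<in> lin_maps D V W"
  using assms V.functional_closed[OF f] unfolding lin_maps_def
  by (auto simp: V.functional_add[OF f] V.functional_rsmult[OF f] W.rsmult_r_distr W.rsmult_assoc)

lemma lin_comb_apply: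
  "x \<in> carrier V \<Longrightarrow> lin_comb V W E w f x = (\<Oplus>\<^bsub>W\<^esub>e\<in>E. w e \<cdot>\<^bsub>W\<^esub> f e x)"
  by (simp add: lin_comb_def)

text \<open>The right side keeps the restricted rank-one map as a subterm, so that it is literally a
  sum in the group of linear maps and closure rules for submodules apply.\<close>

lemma lin_comb_insert:
  assumes "finite E" "e \<notin> E" "w \<in> insert e E \<rightarrow> carrier W"
    and "\<And>i. i \<in> insert e E \<Longrightarrow> functional D V (f i)"
  shows "lin_comb V W (insert e E) w f =
    (\<lambda>x\<in>carrier V. (\<lambda>x\<in>carrier V. w e \<cdot>\<^bsub>W\<^esub> f e x) x \<oplus>\<^bsub>W\<^esub> lin_comb V W E w f x)"
  unfolding lin_comb_def using assms V.functional_closed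
  by (intro restrict_ext, subst W.M.finsum_insert) (auto simp: Pi_iff)

text \<open>Only closure properties of \<open>I\<close> are assumed, so that the lemma serves for
  left submodules, for right submodules and for the set of all linear maps.\<close>

lemma lin_comb_mem:
  assumes E: "finite E" "w \<in> E \<rightarrow> carrier W" "\<And>e. e \<in> E \<Longrightarrow> functional D V (f e)"
    and zero: "(\<lambda>x\<in>carrier V. \<zero>\<^bsub>W\<^esub>) \<in> I"
    and add: "\<And>S T. \<lbrakk>S \<in> I; T \<in> I\<rbrakk> \<Longrightarrow> (\<lambda>x\<in>carrier V. S x \<oplus>\<^bsub>W\<^esub> T x) \<in> I"
    and mem: "\<And>e. e \<in> E \<Longrightarrow> (\<lambda>x\<in>carrier V. w e \<cdot>\<^bsub>W\<^esub> f e x) \<in> I"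
  shows "lin_comb V W E w f \<in> I"
  using E mem
proof (induction E)
  case empty
  show ?case using zero unfolding lin_comb_def W.M.finsum_empty .
next
  case (insert e E)
  then show ?case by (subst lin_comb_insert) (auto intro!: add)
qed

lemma zero_lin_maps: "(\<lambda>x\<in>carrier V. \<zero>\<^bsub>W\<^esub>) \<in> lin_maps D V W"
  unfolding lin_maps_def by auto

lemma add_lin_maps:
  assumes "S \<in> lin_maps D V W" "T \<in> lin_maps D V W"
  shows "(\<lambda>x\<in>carrier V. S x \<oplus>\<^bsub>W\<^esub> T x) \<in> lin_maps D V W"
proof -
  note ST = lin_mapsE[OF assms(1)] lin_mapsE[OF assms(2)]
  show ?thesis unfolding lin_maps_def
    by (auto simp: ST W.M.a_ac W.rsmult_l_distr)
qed

lemma lin_comb_lin_maps: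
  assumes "finite E" "w \<in> E \<rightarrow> carrier W" "\<And>e. e \<in> E \<Longrightarrow> functional D V (f e)"
  shows "lin_comb V W E w f \<in> lin_maps D V W"
  using assms
  by (intro lin_comb_mem zero_lin_maps add_lin_maps rsmult_functional_lin_maps) auto

lemma lin_comb_eqI:
  assumes E: "finite E" "e \<in> E" "w \<in> E \<rightarrow> carrier W" and x: "x \<in> carrier V"
    and f: "\<And>i. i \<in> E \<Longrightarrow> f i x = (if e = i then \<one>\<^bsub>D\<^esub> else \<zero>\<^bsub>D\<^esub>)"
  shows "lin_comb V W E w f x = w e"
proof -
  have "lin_comb V W E w f x = (\<Oplus>\<^bsub>W\<^esub>i\<in>E. if e = i then w i else \<zero>\<^bsub>W\<^esub>)"
    unfolding lin_comb_apply[OF x] using E f by (intro W.M.finsum_cong') (auto simp: Pi_iff)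
  also have "\<dots> = w e"
    using E by (intro W.M.finsum_singleton) auto
  finally show ?thesis .
qed

text \<open>\<open>T\<close> passes through the finite sum and past the scalars, so it acts on the
  vectors alone. By this a single generator is later multiplied into any given map.\<close>

lemma compose_lin_comb:
  assumes T: "T \<in> lin_maps D V W" and "finite E" "v \<in> E \<rightarrow> carrier V"
    and f: "\<And>e x. \<lbrakk>e \<in> E; x \<in> carrier U\<rbrakk> \<Longrightarrow> f e x \<in> carrier D"
  shows "compose (carrier U) T (lin_comb U V E v f) = lin_comb U W E (\<lambda>e. T (v e)) f"
  unfolding compose_def lin_comb_def
proof (rule restrict_ext)
  fix x assume x: "x \<in> carrier U"
  have v: "v e \<in> carrier V" if "e \<in> E" for e using assms(3) that by auto
  have "T (\<Oplus>\<^bsub>V\<^esub>e\<in>E. v e \<cdot>\<^bsub>V\<^esub> f e x) = (\<Oplus>\<^bsub>W\<^esub>e\<in>E. T (v e \<cdot>\<^bsub>V\<^esub> f e x))"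
    using v f x assms(2) by (intro lin_maps_finsum[OF T]) auto
  also have "\<dots> = (\<Oplus>\<^bsub>W\<^esub>e\<in>E. T (v e) \<cdot>\<^bsub>W\<^esub> f e x)"
    using v f x lin_mapsE(2,4)[OF T] by (intro W.M.finsum_cong') auto
  finally show "T ((\<lambda>x\<in>carrier U. \<Oplus>\<^bsub>V\<^esub>e\<in>E. v e \<cdot>\<^bsub>V\<^esub> f e x) x) = (\<Oplus>\<^bsub>W\<^esub>e\<in>E. T (v e) \<cdot>\<^bsub>W\<^esub> f e x)"
    using x by simp
qed

lemma lin_maps_span:
  assumes T: "T \<in> lin_maps D V W" and S: "S \<subseteq> carrier V" and x: "x \<in> right_span D V S"
  shows "T x \<in> right_span D W (T ` S)"
proof -
  have "T ` S \<subseteq> carrier W" using S lin_mapsE(2)[OF T] by auto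
  then have "right_submodule {x \<in> carrier V. T x \<in> right_span D W (T ` S)} D V"
    by (intro lin_maps_preimage_submodule[OF T] W.right_submodule_span)
  moreover have "S \<subseteq> {x \<in> carrier V. T x \<in> right_span D W (T ` S)}"
    using S W.right_span_superset[of "T ` S"] by auto
  ultimately show ?thesis using x V.right_span_minimal by blast
qed

end

section \<open>Projections, dual bases and the exchange argument\<close>

context right_vector_space
begin

interpretation VV: right_vector_space_pair D V V ..

lemma dual_basisE:
  assumes "dual_basis D V E f"
  shows "finite E" "E \<subseteq> carrier V" "\<And>e. e \<in> E \<Longrightarrow> functional D V (f e)"
    "\<And>e e'. \<lbrakk>e \<in> E; e' \<in> E\<rbrakk> \<Longrightarrow> f e e' = (if e = e' then \<one>\<^bsub>D\<^esub> else \<zero>\<^bsub>D\<^esub>)"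
    "(\<lambda>e. e) \<in> E \<rightarrow> carrier V"
  using assms unfolding dual_basis_def by auto

lemma lin_maps_id_minus:
  assumes P: "P \<in> lin_maps D V V"
  shows "(\<lambda>x\<in>carrier V. x \<ominus>\<^bsub>V\<^esub> P x) \<in> lin_maps D V V"
  unfolding lin_maps_def
  using lin_mapsE[OF P] by (auto simp: a_minus_def M.minus_add M.a_ac rsmult_l_distr minus_rsmult)

text \<open>The map \<open>lin_comb V V E (\<lambda>e. e) f\<close> is the projection onto the span of \<open>E\<close> whose
  kernel is the common kernel of the functionals \<open>f e\<close>, if \<open>f\<close> is dual to \<open>E\<close>; the residual
  of \<open>x\<close> is the difference of \<open>x\<close> and its projection.\<close>

lemma functional_residual:
  assumes g: "g \<in> \<Lambda>"
    and \<Lambda>: "\<And>g. g \<in> \<Lambda> \<Longrightarrow> functional D V g"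
    and diff: "\<And>g h a. \<lbrakk>g \<in> \<Lambda>; h \<in> \<Lambda>; a \<in> carrier D\<rbrakk> \<Longrightarrow> (\<lambda>x. g x \<ominus>\<^bsub>D\<^esub> a \<otimes>\<^bsub>D\<^esub> h x) \<in> \<Lambda>"
    and E: "finite E" "E \<subseteq> carrier V" "\<And>e. e \<in> E \<Longrightarrow> f e \<in> \<Lambda>"
  shows "\<exists>h\<in>\<Lambda>. \<forall>y\<in>carrier V. h y = g (y \<ominus>\<^bsub>V\<^esub> lin_comb V V E (\<lambda>e. e) f y)"
  using E
proof (induction E)
  case empty
  then show ?case using g by (auto intro!: bexI[of _ g] simp: lin_comb_def M.minus_eq)
next
  case (insert e E)
  then obtain h where h: "h \<in> \<Lambda>" "\<And>y. y \<in> carrier V \<Longrightarrow> h y = g (y \<ominus>\<^bsub>V\<^esub> lin_comb V V E (\<lambda>e. e) f y)"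
    by auto
  note gf = \<Lambda>[OF g]
  have e: "e \<in> carrier V" "functional D V (f e)" using insert \<Lambda> by auto
  have "lin_comb V V E (\<lambda>e. e) f \<in> lin_maps D V V"
    using insert \<Lambda> by (intro VV.lin_comb_lin_maps) auto
  note P = lin_mapsE(2)[OF this]
  \<comment> \<open>Inserting \<open>e\<close> adds \<open>e \<cdot> f e y\<close> to the
    projection, so \<open>g\<close> of the residual drops by \<open>g e \<otimes> f e y\<close>. The
    new functional is thus \<open>h\<close> minus a left multiple of \<open>f e\<close>.\<close>
  have "h y \<ominus>\<^bsub>D\<^esub> g e \<otimes>\<^bsub>D\<^esub> f e y = g (y \<ominus>\<^bsub>V\<^esub> lin_comb V V (insert e E) (\<lambda>e. e) f y)"
    if y: "y \<in> carrier V" for y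
  proof -
    note fc = functional_closed[OF gf] functional_closed[OF e(2)]
    have ins: "lin_comb V V (insert e E) (\<lambda>e. e) f y = e \<cdot>\<^bsub>V\<^esub> f e y \<oplus>\<^bsub>V\<^esub> lin_comb V V E (\<lambda>e. e) f y"
      using y insert e \<Lambda> by (subst VV.lin_comb_insert) auto
    show ?thesis
      unfolding ins h(2)[OF y] using y P[OF y] e fc
      by (simp add: functional_minus[OF gf] functional_add[OF gf] functional_rsmult[OF gf]
          a_minus_def R.minus_add R.a_ac)
  qed
  then show ?case
    using diff[OF h(1), of "f e" "g e"] insert.prems functional_closed[OF gf e(1)]
    by (intro bexI[of _ "\<lambda>y. h y \<ominus>\<^bsub>D\<^esub> g e \<otimes>\<^bsub>D\<^esub> f e y"]) auto
qed

text \<open>Gram-Schmidt with functionals: a vector \<open>x\<close> whose residual \<open>r\<close> is not yet in \<open>K\<close>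
  contributes \<open>r\<close> itself, paired with a functional that is first normalised at \<open>r\<close> and then
  composed with the residual map; the functionals found before vanish at \<open>r\<close>.\<close>

lemma dual_basis_exists:
  assumes \<Lambda>: "\<And>g. g \<in> \<Lambda> \<Longrightarrow> functional D V g"
    and diff: "\<And>g h a. \<lbrakk>g \<in> \<Lambda>; h \<in> \<Lambda>; a \<in> carrier D\<rbrakk> \<Longrightarrow> (\<lambda>x. g x \<ominus>\<^bsub>D\<^esub> a \<otimes>\<^bsub>D\<^esub> h x) \<in> \<Lambda>"
    and lmult: "\<And>g a. \<lbrakk>g \<in> \<Lambda>; a \<in> carrier D\<rbrakk> \<Longrightarrow> (\<lambda>x. a \<otimes>\<^bsub>D\<^esub> g x) \<in> \<Lambda>"
    and X: "right_submodule X D V" and K: "right_submodule K D V"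
    and vanish: "\<And>g x. \<lbrakk>g \<in> \<Lambda>; x \<in> K\<rbrakk> \<Longrightarrow> g x = \<zero>\<^bsub>D\<^esub>"
    and sep: "\<And>x. \<lbrakk>x \<in> X; x \<notin> K\<rbrakk> \<Longrightarrow> \<exists>g\<in>\<Lambda>. g x \<noteq> \<zero>\<^bsub>D\<^esub>"
    and F: "finite F" "F \<subseteq> X"
  shows "\<exists>E f. dual_basis D V E f \<and> E \<subseteq> X \<and> f \<in> E \<rightarrow> \<Lambda> \<and>
    (\<forall>x\<in>F. x \<ominus>\<^bsub>V\<^esub> lin_comb V V E (\<lambda>e. e) f x \<in> K)"
  using F
proof (induction F)
  case empty
  have "dual_basis D V {} (\<lambda>_ _. \<zero>\<^bsub>D\<^esub>)" by (simp add: dual_basis_def)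
  then show ?case by auto
next
  case (insert x F)
  then obtain E f where E: "dual_basis D V E f" "E \<subseteq> X" "f \<in> E \<rightarrow> \<Lambda>"
    and res: "\<And>y. y \<in> F \<Longrightarrow> y \<ominus>\<^bsub>V\<^esub> lin_comb V V E (\<lambda>e. e) f y \<in> K"
    by auto
  note EE = dual_basisE[OF E(1)]
  note XE = right_submoduleE[OF X] and KE = right_submoduleE[OF K]
  define P where "P = lin_comb V V E (\<lambda>e. e) f"
  have P: "P \<in> lin_maps D V V"
    unfolding P_def using EE by (intro VV.lin_comb_lin_maps) auto
  note PV = lin_mapsE(2)[OF P]
  have PX: "P y \<in> X" if "y \<in> carrier V" for y
    unfolding P_def VV.lin_comb_apply[OF that]
    using EE E(2) functional_closed that
    by (intro right_submodule_finsum[OF X]) (auto intro!: XE(6))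
  define r where "r = x \<ominus>\<^bsub>V\<^esub> P x"
  have xX: "x \<in> X" and xV: "x \<in> carrier V" using insert XE(1) by auto
  have rX: "r \<in> X" and rV: "r \<in> carrier V" using xX xV PX XE(1,5) unfolding r_def by auto
  show ?case
  proof (cases "r \<in> K")
    case True
    then show ?thesis using E res unfolding r_def P_def by blast
  next
    case False
    obtain g0 where g0: "g0 \<in> \<Lambda>" "g0 r \<noteq> \<zero>\<^bsub>D\<^esub>" using sep[OF rX False] by auto
    \<comment> \<open>Functionals are scaled from the left, so a left inverse of \<open>g0 r\<close>
      is the one that normalises.\<close>
    obtain c where c: "c \<in> carrier D" "c \<otimes>\<^bsub>D\<^esub> g0 r = \<one>\<^bsub>D\<^esub>"
      using left_inverse[OF functional_closed[OF \<Lambda>[OF g0(1)] rV] g0(2)] by blast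
    define g where "g = (\<lambda>x. c \<otimes>\<^bsub>D\<^esub> g0 x)"
    have g: "g \<in> \<Lambda>" "g r = \<one>\<^bsub>D\<^esub>" using lmult g0 c unfolding g_def by auto
    note gf = \<Lambda>[OF g(1)]
    \<comment> \<open>\<open>h\<close> is \<open>g\<close> composed with the residual map. It stays
      in \<open>\<Lambda>\<close> by \<open>functional_residual\<close> and, as \<open>P\<close>
      fixes \<open>E\<close>, it vanishes on \<open>E\<close>.\<close>
    obtain h where h: "h \<in> \<Lambda>" "\<And>y. y \<in> carrier V \<Longrightarrow> h y = g (y \<ominus>\<^bsub>V\<^esub> P y)"
      using functional_residual[OF g(1) \<Lambda> diff EE(1,2)] E(3) unfolding P_def by blast
    have Pe: "P e = e" if "e \<in> E" for e
      unfolding P_def using EE(2,4) that by (intro VV.lin_comb_eqI EE(1,5)) auto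
    \<comment> \<open>By duality \<open>f e\<close> does not see the difference between
      \<open>y\<close> and \<open>P y\<close>, so it vanishes at the residual
      \<open>r\<close>.\<close>
    have fr: "f e r = \<zero>\<^bsub>D\<^esub>" if e: "e \<in> E" for e
    proof -
      have fP: "f e (P y) = f e y" if y: "y \<in> carrier V" for y
      proof -
        have yc: "f i y \<in> carrier D" if "i \<in> E" for i
          using functional_closed[OF EE(3)] that y by blast
        have "f e (P y) = (\<Oplus>\<^bsub>D\<^esub>i\<in>E. f e (i \<cdot>\<^bsub>V\<^esub> f i y))"
          unfolding P_def VV.lin_comb_apply[OF y] using EE yc
          by (intro functional_finsum[OF EE(3)[OF e]]) auto
        also have "\<dots> = (\<Oplus>\<^bsub>D\<^esub>i\<in>E. if e = i then f i y else \<zero>\<^bsub>D\<^esub>)"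
        proof (rule R.finsum_cong')
          fix i assume i: "i \<in> E"
          then have "f e (i \<cdot>\<^bsub>V\<^esub> f i y) = f e i \<otimes>\<^bsub>D\<^esub> f i y"
            using functional_rsmult[OF EE(3)[OF e]] EE(2) yc by blast
          then show "f e (i \<cdot>\<^bsub>V\<^esub> f i y) = (if e = i then f i y else \<zero>\<^bsub>D\<^esub>)"
            using EE(4)[OF e i] yc[OF i] by simp
        qed (use yc in auto)
        also have "\<dots> = f e y" using e EE yc by (intro R.finsum_singleton) auto
        finally show ?thesis .
      qed
      show ?thesis
        unfolding r_def using functional_diff[OF EE(3)[OF e] xV PV[OF xV]] fP[OF xV]
          functional_closed[OF EE(3)[OF e] xV] by (simp add: R.minus_eq R.r_neg)
    qed
    \<comment> \<open>All coefficients of \<open>r\<close> vanish, so \<open>r\<close> is its own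
      residual and \<open>h r\<close> equals \<open>g r\<close>.\<close>
    have "P r = (\<Oplus>\<^bsub>V\<^esub>e\<in>E. \<zero>\<^bsub>V\<^esub>)"
      unfolding P_def VV.lin_comb_apply[OF rV] using EE fr
      by (intro M.finsum_cong') auto
    then have hr: "h r = \<one>\<^bsub>D\<^esub>" using h(2)[OF rV] g(2) rV by (simp add: M.minus_eq)
    have he: "h e = \<zero>\<^bsub>D\<^esub>" if "e \<in> E" for e
      using h(2)[of e] Pe[OF that] that EE(2) functional_zero[OF gf]
      by (auto simp: M.minus_eq M.r_neg subset_eq)
    \<comment> \<open>\<open>h\<close> is one at \<open>r\<close> and zero on \<open>E\<close>, so
      \<open>r\<close> is new and the update of \<open>f\<close> at \<open>r\<close> overwrites no
      earlier functional.\<close>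
    have rE: "r \<notin> E" using he hr one_neq_zero by auto
    define f' where "f' = f(r := h)"
    have f'r: "f' r = h" by (simp add: f'_def)
    have E': "dual_basis D V (insert r E) f'"
      using E EE rV hr he fr rE \<Lambda>[OF h(1)] unfolding dual_basis_def f'_def by auto
    have P': "y \<ominus>\<^bsub>V\<^esub> lin_comb V V (insert r E) (\<lambda>e. e) f' y = (y \<ominus>\<^bsub>V\<^esub> P y) \<ominus>\<^bsub>V\<^esub> r \<cdot>\<^bsub>V\<^esub> h y"
      if y: "y \<in> carrier V" for y
    proof -
      have "lin_comb V V (insert r E) (\<lambda>e. e) f' y =
          r \<cdot>\<^bsub>V\<^esub> f' r y \<oplus>\<^bsub>V\<^esub> lin_comb V V E (\<lambda>e. e) f' y"
        using y EE rE rV dual_basisE[OF E'] by (subst VV.lin_comb_insert) auto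
      also have "lin_comb V V E (\<lambda>e. e) f' y = P y"
        unfolding P_def VV.lin_comb_apply[OF y] using EE rE functional_closed[OF EE(3)] y
        by (intro M.finsum_cong') (auto simp: f'_def)
      finally show ?thesis
        using y rV PV[OF y] functional_closed[OF \<Lambda>[OF h(1)] y]
        by (simp add: f'r a_minus_def M.minus_add M.a_ac)
    qed
    have "y \<ominus>\<^bsub>V\<^esub> lin_comb V V (insert r E) (\<lambda>e. e) f' y \<in> K" if y: "y \<in> insert x F" for y
    proof (cases "y = x")
      case True
      \<comment> \<open>Since \<open>h x\<close> is \<open>g r\<close>, the new residual of
        \<open>x\<close> is \<open>r\<close> minus \<open>r\<close>, which is zero.\<close>
      have "h x = \<one>\<^bsub>D\<^esub>" using h(2)[OF xV] g(2) unfolding r_def by simp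
      then have "(x \<ominus>\<^bsub>V\<^esub> P x) \<ominus>\<^bsub>V\<^esub> r \<cdot>\<^bsub>V\<^esub> h x = \<zero>\<^bsub>V\<^esub>"
        using rV by (simp add: M.minus_eq M.r_neg flip: r_def[unfolded M.minus_eq])
      then show ?thesis using P'[OF xV] True KE(2) by simp
    next
      case False
      then have yF: "y \<in> F" and yV: "y \<in> carrier V" using y insert XE(1) by auto
      have k: "y \<ominus>\<^bsub>V\<^esub> P y \<in> K" using res[OF yF] unfolding P_def .
      \<comment> \<open>The old residual of \<open>y\<close> lies in \<open>K\<close>, where
        \<open>g\<close> vanishes, so the new vector does not change it.\<close>
      then have "h y = \<zero>\<^bsub>D\<^esub>" using h(2)[OF yV] vanish[OF g(1)] by simp
      then show ?thesis using P'[OF yV] k KE(1) rV yV PV by (simp add: M.minus_eq)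
    qed
    moreover have "f' \<in> insert r E \<rightarrow> \<Lambda>" "insert r E \<subseteq> X"
      using E h rX unfolding f'_def by auto
    ultimately show ?thesis using E' by blast
  qed
qed

text \<open>This is the preimage of \<open>K\<close> under the identity minus the projection. It
  carries the result of the Gram-Schmidt process from finitely many vectors to everything they
  span.\<close>

lemma residual_submodule:
  assumes E: "dual_basis D V E f" and K: "right_submodule K D V"
  shows "right_submodule {x \<in> carrier V. x \<ominus>\<^bsub>V\<^esub> lin_comb V V E (\<lambda>e. e) f x \<in> K} D V"
proof -
  have "lin_comb V V E (\<lambda>e. e) f \<in> lin_maps D V V"
    using dual_basisE[OF E] by (intro VV.lin_comb_lin_maps) auto
  from VV.lin_maps_preimage_submodule[OF lin_maps_id_minus[OF this] K]
  show ?thesis by (simp cong: conj_cong)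
qed

text \<open>Each step removes a spanning vector \<open>b\<close> by applying a linear map that kills \<open>b\<close> and fixes
  all but at most one of the vectors of \<open>E\<close>.\<close>

lemma dual_basis_card_le:
  assumes "dual_basis D V E f" "finite B" "B \<subseteq> carrier V" "E \<subseteq> right_span D V B" "card B \<le> m"
  shows "card E \<le> m"
  using assms
proof (induction m arbitrary: B E f)
  case 0
  note EE = dual_basisE[OF 0(1)]
  have "right_span D V {} = {\<zero>\<^bsub>V\<^esub>}"
    using right_span_minimal[OF _ right_submodule_zero, of "{}"]
      right_submoduleE(2)[OF right_submodule_span, of "{}"] by auto
  then have "E \<subseteq> {\<zero>\<^bsub>V\<^esub>}" using 0 by simp
  \<comment> \<open>A functional vanishes at zero, while its value at its own dual vector is
    one.\<close>
  moreover have "\<zero>\<^bsub>V\<^esub> \<notin> E"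
    using EE(4)[of "\<zero>\<^bsub>V\<^esub>" "\<zero>\<^bsub>V\<^esub>"] functional_zero[OF EE(3)] one_neq_zero by auto
  ultimately have "E = {}" by auto
  then show ?case by simp
next
  case (Suc m)
  note EE = dual_basisE[OF Suc(2)]
  \<comment> \<open>\<open>T\<close> sends the span of \<open>B\<close> into the span of the images
    of the other vectors, and it fixes \<open>E'\<close>. So \<open>E'\<close> is spanned by at most
    \<open>m\<close> vectors and the induction hypothesis applies.\<close>
  have reduce: "card E' \<le> m" if "b \<in> B" "T \<in> lin_maps D V V" "T b = \<zero>\<^bsub>V\<^esub>" "E' \<subseteq> E" "\<And>e. e \<in> E' \<Longrightarrow> T e = e"
    for b T E'
  proof (rule Suc.IH)
    define C where "C = T ` (B - {b})"
    show "dual_basis D V E' f"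
      using Suc(2) \<open>E' \<subseteq> E\<close> finite_subset unfolding dual_basis_def by blast
    show "finite C" using Suc by (simp add: C_def)
    show CV: "C \<subseteq> carrier V" using Suc lin_mapsE(2)[OF that(2)] unfolding C_def by auto
    show "card C \<le> m"
      using Suc(3,6) \<open>b \<in> B\<close> card_image_le[of "B - {b}" T] unfolding C_def by simp
    show "E' \<subseteq> right_span D V C"
    proof
      fix e assume e: "e \<in> E'"
      have "T ` B \<subseteq> right_span D V C"
      proof
        fix y assume "y \<in> T ` B"
        then have "y \<in> C \<or> y = \<zero>\<^bsub>V\<^esub>" using that(3) unfolding C_def by auto
        then show "y \<in> right_span D V C"
          using right_span_superset[of C] right_submoduleE(2)[OF right_submodule_span[OF CV]] by auto
      qed
      then have "right_span D V (T ` B) \<subseteq> right_span D V C"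
        by (intro right_span_minimal right_submodule_span[OF CV])
      moreover have "T e \<in> right_span D V (T ` B)"
        using VV.lin_maps_span[OF that(2) Suc(4)] Suc(5) e that(4) by auto
      ultimately show "e \<in> right_span D V C" using that(5)[OF e] by auto
    qed
  qed
  show ?case
  proof (cases "B = {}")
    case True
    then show ?thesis using Suc.IH[OF Suc(2-5)] by simp
  next
    case False
    then obtain b where b: "b \<in> B" by auto
    then have bV: "b \<in> carrier V" using Suc by auto
    show ?thesis
    proof (cases "\<exists>e\<in>E. f e b \<noteq> \<zero>\<^bsub>D\<^esub>")
      case True
      then obtain i where i: "i \<in> E" "f i b \<noteq> \<zero>\<^bsub>D\<^esub>" by auto
      then obtain c where c: "c \<in> carrier D" "c \<otimes>\<^bsub>D\<^esub> f i b = \<one>\<^bsub>D\<^esub>"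
        using left_inverse[OF functional_closed[OF EE(3)[OF i(1)] bV]] by blast
      \<comment> \<open>The functional \<open>c \<otimes> f i\<close> is one at \<open>b\<close>, so
        the identity minus \<open>P\<close> kills \<open>b\<close>. It fixes every \<open>e\<close>
        other than \<open>i\<close>, because \<open>f i\<close> vanishes there.\<close>
      define P where "P = (\<lambda>x\<in>carrier V. b \<cdot>\<^bsub>V\<^esub> (c \<otimes>\<^bsub>D\<^esub> f i x))"
      have P: "P \<in> lin_maps D V V"
        unfolding P_def by (intro VV.rsmult_functional_lin_maps functional_lmult EE(3) bV c i)
      have "card (E - {i}) \<le> m"
      proof (rule reduce[OF b lin_maps_id_minus[OF P]])
        show "(\<lambda>x\<in>carrier V. x \<ominus>\<^bsub>V\<^esub> P x) b = \<zero>\<^bsub>V\<^esub>"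
          using bV c by (simp add: P_def M.minus_eq M.r_neg)
        fix e assume e: "e \<in> E - {i}"
        then have "f i e = \<zero>\<^bsub>D\<^esub>" "e \<in> carrier V" using EE i by auto
        then show "(\<lambda>x\<in>carrier V. x \<ominus>\<^bsub>V\<^esub> P x) e = e"
          using c bV by (simp add: P_def M.minus_eq)
      qed auto
      then show ?thesis using i EE(1) by (simp add: card_Diff_singleton)
    next
      case False
      \<comment> \<open>All functionals of the family vanish at \<open>b\<close>, so the projection
        itself kills \<open>b\<close> and fixes the whole of \<open>E\<close>.\<close>
      have "card E \<le> m"
      proof (rule reduce[OF b])
        show "lin_comb V V E (\<lambda>e. e) f \<in> lin_maps D V V"
          using EE by (intro VV.lin_comb_lin_maps) auto
        have "(\<Oplus>\<^bsub>V\<^esub>e\<in>E. e \<cdot>\<^bsub>V\<^esub> f e b) = (\<Oplus>\<^bsub>V\<^esub>e\<in>E. \<zero>\<^bsub>V\<^esub>)"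
          using False EE by (intro M.finsum_cong') auto
        then show "lin_comb V V E (\<lambda>e. e) f b = \<zero>\<^bsub>V\<^esub>"
          by (simp add: VV.lin_comb_apply[OF bV])
        show "lin_comb V V E (\<lambda>e. e) f e = e" if "e \<in> E" for e
          using EE(2,4) that by (intro VV.lin_comb_eqI EE(1,5)) auto
      qed auto
      then show ?thesis by simp
    qed
  qed
qed

text \<open>The exchange argument settles a finite \<open>B\<close>. In an infinite \<open>B\<close>
  there is a finite subset of the size of \<open>E\<close>.\<close>

lemma dual_basis_ordLeq:
  assumes E: "dual_basis D V E f" and B: "is_basis D V B"
  shows "|E| \<le>o |B|"
proof (cases "finite B")
  case True
  have "card E \<le> card B"
    using dual_basis_card_le[OF E True] B dual_basisE(2)[OF E] unfolding is_basis_def by auto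
  then obtain g where "inj_on g E" "g ` E \<subseteq> B"
    using inj_on_iff_card_le[OF dual_basisE(1)[OF E] True] by blast
  then show ?thesis using card_of_ordLeq by blast
next
  case False
  then obtain C where "C \<subseteq> B" "finite C" "card C = card E"
    using infinite_arbitrarily_large by blast
  then obtain g where "inj_on g E" "g ` E \<subseteq> B"
    using inj_on_iff_card_le[OF dual_basisE(1)[OF E], of C] by auto
  then show ?thesis using card_of_ordLeq by blast
qed

section \<open>Dimension, and bases of subspaces and quotients\<close>

lemma vdim_basis:
  obtains B where "is_basis D V B" "vdim D V = |B|"
  using someI_ex[OF basis_exists] unfolding vdim_def by blast

text \<open>\<open>B\<close> spans inside the record whose carrier is cut down to \<open>U\<close>.
  The span of \<open>B\<close> taken in \<open>V\<close> is a submodule of that record too, so the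
  hull formed there lies inside it.\<close>

lemma submodule_basis_span:
  assumes U: "right_submodule U D V" and B: "is_basis D (V\<lparr>carrier := U\<rparr>) B"
  shows "B \<subseteq> U" "U \<subseteq> right_span D V B"
proof -
  show BU: "B \<subseteq> U" using B unfolding is_basis_def by simp
  note UE = right_submoduleE[OF U]
  define H where "H = right_span D V B"
  have HU: "H \<subseteq> U" unfolding H_def by (rule right_span_minimal[OF BU U])
  have H: "right_submodule H D V"
    unfolding H_def using BU UE(1) by (intro right_submodule_span) auto
  \<comment> \<open>An inverse is defined by a search over the carrier, so the smaller carrier has
    to be shown to yield the same element.\<close>
  have inv: "inv\<^bsub>add_monoid (V\<lparr>carrier := U\<rparr>)\<^esub> x = \<ominus>\<^bsub>V\<^esub> x" if "x \<in> U" for x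
  proof -
    have "subgroup U (add_monoid V)" using U unfolding right_submodule_def by simp
    from group.m_inv_consistent[OF M.a_group this that] show ?thesis
      by (simp add: a_inv_def)
  qed
  have "right_submodule H D (V\<lparr>carrier := U\<rparr>)"
    unfolding right_submodule_def right_submodule_axioms_def subgroup_def
    using HU right_submoduleE[OF H] inv by auto
  moreover have "B \<subseteq> H" unfolding H_def by (rule right_span_superset)
  ultimately have "right_span D (V\<lparr>carrier := U\<rparr>) B \<subseteq> H"
    unfolding right_span_def by (intro hull_minimal)
  then show "U \<subseteq> right_span D V B"
    using B unfolding is_basis_def H_def by simp
qed

text \<open>Representatives of a finite basis of the quotient span the space modulo
  \<open>K\<close>. The conclusion speaks of subspaces of \<open>V\<close> only, so that cosets do
  not occur in the later argument.\<close>

lemma fin_dim_quotE: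
  assumes K: "right_submodule K D V" and fin: "fin_dim D (quot_space V K)"
  obtains F where "finite F" "F \<subseteq> carrier V"
    "\<And>P. \<lbrakk>right_submodule P D V; K \<subseteq> P; F \<subseteq> P\<rbrakk> \<Longrightarrow> P = carrier V"
proof -
  let ?Q = "quot_space V K"
  note KE = right_submoduleE[OF K]
  interpret S: abelian_subgroup K V
    using K by (intro abelian_subgroupI3 additive_subgroup.intro M.abelian_group_axioms)
      (simp add: right_submodule_def)
  have coset: "K +>\<^bsub>V\<^esub> x = (\<lambda>k. k \<oplus>\<^bsub>V\<^esub> x) ` K" for x
    by (auto simp: a_r_coset_def r_coset_def)
  have coset_eq: "K +>\<^bsub>V\<^esub> y = K +>\<^bsub>V\<^esub> x" if "x \<in> carrier V" "y \<in> K +>\<^bsub>V\<^esub> x" for x y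
    using S.a_repr_independence'[OF that(2,1)] by simp
  have carrQ: "carrier ?Q = (\<lambda>x. K +>\<^bsub>V\<^esub> x) ` carrier V"
    by (auto simp: quot_space_def A_RCOSETS_def RCOSETS_def a_r_coset_def)
  \<comment> \<open>As an additive group, \<open>quot_space V K\<close> has the carrier, sum and
    zero of \<open>V A_Mod K\<close>, from which the inverses of cosets are taken.\<close>
  have carr_Mod: "carrier (V A_Mod K) = carrier ?Q"
    by (simp add: quot_space_def A_FactGroup_def FactGroup_def A_RCOSETS_def)
  have inv_Mod: "inv\<^bsub>add_monoid ?Q\<^esub> X = inv\<^bsub>V A_Mod K\<^esub> X" for X
    by (simp add: m_inv_def quot_space_def A_FactGroup_def FactGroup_def A_RCOSETS_def set_add_def)
  \<comment> \<open>All cosets in the union that defines the scalar multiple coincide, because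
    \<open>(k + x) a = k a + x a\<close> with \<open>k a\<close> in \<open>K\<close>.\<close>
  have smultQ: "(K +>\<^bsub>V\<^esub> x) \<cdot>\<^bsub>?Q\<^esub> a = K +>\<^bsub>V\<^esub> (x \<cdot>\<^bsub>V\<^esub> a)" if x: "x \<in> carrier V" and a: "a \<in> carrier D" for x a
  proof -
    have "K +>\<^bsub>V\<^esub> (y \<cdot>\<^bsub>V\<^esub> a) = K +>\<^bsub>V\<^esub> (x \<cdot>\<^bsub>V\<^esub> a)" if y: "y \<in> K +>\<^bsub>V\<^esub> x" for y
    proof (rule coset_eq)
      obtain k where "k \<in> K" "y = k \<oplus>\<^bsub>V\<^esub> x" using y coset by auto
      then show "y \<cdot>\<^bsub>V\<^esub> a \<in> K +>\<^bsub>V\<^esub> (x \<cdot>\<^bsub>V\<^esub> a)"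
        using KE(1,6) x a unfolding coset by (auto simp: rsmult_l_distr subset_eq)
    qed (use x a in auto)
    then have "(\<Union>y\<in>K +>\<^bsub>V\<^esub> x. K +>\<^bsub>V\<^esub> (y \<cdot>\<^bsub>V\<^esub> a)) = K +>\<^bsub>V\<^esub> (x \<cdot>\<^bsub>V\<^esub> a)"
      by (intro UN_constant_eq[OF S.a_rcos_self[OF x]]) blast
    then show ?thesis by (simp add: quot_space_def)
  qed
  obtain B where B: "finite B" "is_basis D ?Q B" using fin unfolding fin_dim_def by auto
  have "\<forall>X\<in>B. \<exists>x\<in>carrier V. X = K +>\<^bsub>V\<^esub> x"
    using B(2) carrQ unfolding is_basis_def by auto
  then obtain rep where rep: "\<And>X. X \<in> B \<Longrightarrow> rep X \<in> carrier V \<and> X = K +>\<^bsub>V\<^esub> rep X" by metis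
  show thesis
  proof
    show "finite (rep ` B)" "rep ` B \<subseteq> carrier V" using B rep by auto
    fix P assume P: "right_submodule P D V" "K \<subseteq> P" "rep ` B \<subseteq> P"
    note PE = right_submoduleE[OF P(1)]
    \<comment> \<open>The image of \<open>P\<close> in the quotient is a submodule containing the
      basis, hence it is the whole quotient.\<close>
    define H where "H = (\<lambda>x. K +>\<^bsub>V\<^esub> x) ` P"
    have "right_submodule H D ?Q"
      unfolding right_submodule_def right_submodule_axioms_def subgroup_def
    proof (intro conjI allI impI)
      show "H \<subseteq> carrier (add_monoid ?Q)"
        using carrQ PE(1) unfolding H_def by auto
      show "X \<otimes>\<^bsub>add_monoid ?Q\<^esub> Y \<in> H" if "X \<in> H" "Y \<in> H" for X Y
        using that S.a_rcos_sum PE(1,3) unfolding H_def by (auto simp: quot_space_def subset_eq)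
      have "(\<lambda>k. k \<oplus>\<^bsub>V\<^esub> \<zero>\<^bsub>V\<^esub>) ` K = (\<lambda>k. k) ` K" using KE(1) by (intro image_cong) auto
      then have "K = K +>\<^bsub>V\<^esub> \<zero>\<^bsub>V\<^esub>" using coset[of "\<zero>\<^bsub>V\<^esub>"] by simp
      then show "\<one>\<^bsub>add_monoid ?Q\<^esub> \<in> H"
        using PE(2) unfolding H_def by (auto simp: quot_space_def)
      show "inv\<^bsub>add_monoid ?Q\<^esub> X \<in> H" if X: "X \<in> H" for X
      proof -
        obtain x where x: "x \<in> P" "x \<in> carrier V" "X = K +>\<^bsub>V\<^esub> x" using X PE(1) unfolding H_def by auto
        then have "X \<in> carrier (V A_Mod K)"
          using carrQ carr_Mod by simp
        then have "inv\<^bsub>add_monoid ?Q\<^esub> X = a_set_inv\<^bsub>V\<^esub> X"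
          unfolding inv_Mod by (rule S.a_inv_FactGroup)
        then show ?thesis using S.a_rcos_inv x PE(4) unfolding H_def by auto
      qed
      show "X \<cdot>\<^bsub>?Q\<^esub> a \<in> H" if "X \<in> H" "a \<in> carrier D" for X a
        using that smultQ PE(1,6) unfolding H_def by (auto simp: subset_eq)
    qed
    moreover have "B \<subseteq> H" using P(3) rep unfolding H_def by blast
    ultimately have "right_span D ?Q B \<subseteq> H"
      unfolding right_span_def by (intro hull_minimal)
    then have "carrier ?Q \<subseteq> H"
      using B(2) unfolding is_basis_def by simp
    have "x \<in> P" if x: "x \<in> carrier V" for x
    proof -
      have "K +>\<^bsub>V\<^esub> x \<in> H" using \<open>carrier ?Q \<subseteq> H\<close> carrQ x by auto
      then obtain p where p: "p \<in> P" "K +>\<^bsub>V\<^esub> x = K +>\<^bsub>V\<^esub> p" unfolding H_def by auto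
      \<comment> \<open>Back in \<open>V\<close>: \<open>x\<close> differs from a vector of
        \<open>P\<close> by an element of \<open>K\<close>, and \<open>K\<close> lies in
        \<open>P\<close>.\<close>
      have "x \<in> K +>\<^bsub>V\<^esub> p" using S.a_rcos_self[OF x] p(2) by simp
      then obtain k where "k \<in> K" "x = k \<oplus>\<^bsub>V\<^esub> p" using coset[of p] by auto
      then show ?thesis using P(2) PE(3) p(1) by auto
    qed
    then show "P = carrier V" using PE(1) by auto
  qed
qed

end

section \<open>Submodules of linear maps and transfer of dual bases\<close>

lemma right_submodule_HomE:
  assumes "right_submodule H (End_ring D V) (Hom_right D V W)"
  shows "H \<subseteq> lin_maps D V W" "(\<lambda>x\<in>carrier V. \<zero>\<^bsub>W\<^esub>) \<in> H"
    and "\<And>S T. \<lbrakk>S \<in> H; T \<in> H\<rbrakk> \<Longrightarrow> (\<lambda>x\<in>carrier V. S x \<oplus>\<^bsub>W\<^esub> T x) \<in> H"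
    and "\<And>T A. \<lbrakk>T \<in> H; A \<in> lin_maps D V V\<rbrakk> \<Longrightarrow> compose (carrier V) T A \<in> H"
  using assms
  unfolding right_submodule_def right_submodule_axioms_def subgroup_def Hom_right_def End_ring_def
  by simp_all

lemma submodule_HomE:
  assumes "submodule H (End_ring D W) (Hom_left D V W)"
  shows "H \<subseteq> lin_maps D V W" "(\<lambda>x\<in>carrier V. \<zero>\<^bsub>W\<^esub>) \<in> H"
    and "\<And>S T. \<lbrakk>S \<in> H; T \<in> H\<rbrakk> \<Longrightarrow> (\<lambda>x\<in>carrier V. S x \<oplus>\<^bsub>W\<^esub> T x) \<in> H"
    and "\<And>T A. \<lbrakk>T \<in> H; A \<in> lin_maps D W W\<rbrakk> \<Longrightarrow> compose (carrier V) A T \<in> H"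
  using assms
  unfolding submodule_def submodule_axioms_def subgroup_def Hom_left_def End_ring_def
  by simp_all

context right_vector_space_pair
begin

text \<open>\<open>E\<close> is no larger than a basis of \<open>V\<close>, hence no larger than a
  basis of \<open>W\<close>, into which it injects; coordinate functionals give the duals. The
  family found in \<open>W\<close> is the partner of \<open>E\<close> in a single generator.\<close>

lemma dual_basis_transfer:
  assumes E: "dual_basis D V E f" and le: "vdim D V \<le>o vdim D W"
  obtains g \<phi> where "inj_on g E" "dual_basis D W (g ` E) \<phi>"
proof -
  obtain B where B: "is_basis D V B" "vdim D V = |B|" by (rule V.vdim_basis)
  obtain C where C: "is_basis D W C" "vdim D W = |C|" by (rule W.vdim_basis)
  have "|E| \<le>o |C|"
    using ordLeq_transitive[OF V.dual_basis_ordLeq[OF E B(1)]] le B(2) C(2) by simp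
  then obtain g where g: "inj_on g E" "g ` E \<subseteq> C" by (auto simp flip: card_of_ordLeq)
  obtain \<phi> where "dual_basis D W (g ` E) \<phi>"
    using W.basis_dual_basis[OF C(1) _ g(2)] V.dual_basisE(1)[OF E] by auto
  then show thesis using that g(1) by blast
qed

end

section \<open>The right version\<close>

context right_vector_space_pair
begin

interpretation VV: right_vector_space_pair D V V ..
interpretation WW: right_vector_space_pair D W W ..
interpretation WV: right_vector_space_pair D W V ..

lemma right_submodule_im_fam:
  assumes "I \<subseteq> lin_maps D V W"
  shows "right_submodule (im_fam D V W I) D W"
  unfolding im_fam_def using assms by (intro W.right_submodule_span) (auto dest: lin_mapsE(2))

text \<open>One finite set of generators serves all functionals \<open>f\<close> at once: the vectors with this
  property form a subspace, and \<open>A x\<close> has it because \<open>(A x) f = A \<circ> (x f)\<close>.\<close>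

lemma im_fam_rank_one:
  assumes I: "I \<subseteq> lin_maps D V W" and w: "w \<in> im_fam D V W I"
  obtains S where "finite S" "S \<subseteq> I"
    "\<And>H f. \<lbrakk>right_submodule H (End_ring D V) (Hom_right D V W); S \<subseteq> H; functional D V f\<rbrakk>
      \<Longrightarrow> (\<lambda>x\<in>carrier V. w \<cdot>\<^bsub>W\<^esub> f x) \<in> H"
proof -
  \<comment> \<open>Generation is phrased as membership in every submodule \<open>H\<close> above
    \<open>S\<close>, which is what belonging to the hull of \<open>S\<close> means.\<close>
  define gen where "gen w S \<longleftrightarrow> finite S \<and> S \<subseteq> I \<and>
    (\<forall>H f. right_submodule H (End_ring D V) (Hom_right D V W) \<and> S \<subseteq> H \<and> functional D V f
      \<longrightarrow> (\<lambda>x\<in>carrier V. w \<cdot>\<^bsub>W\<^esub> f x) \<in> H)" for w S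
  have genE: "(\<lambda>x\<in>carrier V. w \<cdot>\<^bsub>W\<^esub> f x) \<in> H"
    if "gen w S" "right_submodule H (End_ring D V) (Hom_right D V W)" "S \<subseteq> H" "functional D V f"
    for w S H f
    using that unfolding gen_def by blast
  define Q where "Q = {w \<in> carrier W. \<exists>S. gen w S}"
  have "right_submodule Q D W"
  proof (rule W.right_submoduleI)
    show "\<zero>\<^bsub>W\<^esub> \<in> Q"
    proof -
      have "(\<lambda>x\<in>carrier V. \<zero>\<^bsub>W\<^esub> \<cdot>\<^bsub>W\<^esub> f x) \<in> H"
        if "right_submodule H (End_ring D V) (Hom_right D V W)" "functional D V f" for H f
      proof -
        have "(\<lambda>x\<in>carrier V. \<zero>\<^bsub>W\<^esub> \<cdot>\<^bsub>W\<^esub> f x) = (\<lambda>x\<in>carrier V. \<zero>\<^bsub>W\<^esub>)"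
          using V.functional_closed[OF that(2)] by (intro restrict_ext) simp
        then show ?thesis using right_submodule_HomE(2)[OF that(1)] by simp
      qed
      then have "gen \<zero>\<^bsub>W\<^esub> {}" unfolding gen_def by blast
      then show ?thesis unfolding Q_def by auto
    qed
    show "x \<oplus>\<^bsub>W\<^esub> y \<in> Q" if x: "x \<in> Q" and y: "y \<in> Q" for x y
    proof -
      obtain S T where S: "gen x S" and T: "gen y T" and W: "x \<in> carrier W" "y \<in> carrier W"
        using x y unfolding Q_def by auto
      have "(\<lambda>z\<in>carrier V. (x \<oplus>\<^bsub>W\<^esub> y) \<cdot>\<^bsub>W\<^esub> f z) \<in> H"
        if H: "right_submodule H (End_ring D V) (Hom_right D V W)" "S \<union> T \<subseteq> H" "functional D V f" for H f
      proof -
        have "(\<lambda>z\<in>carrier V. (\<lambda>z\<in>carrier V. x \<cdot>\<^bsub>W\<^esub> f z) z \<oplus>\<^bsub>W\<^esub> (\<lambda>z\<in>carrier V. y \<cdot>\<^bsub>W\<^esub> f z) z) \<in> H"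
          using H by (intro right_submodule_HomE(3)[OF H(1)] genE[OF S H(1)] genE[OF T H(1)]) auto
        also have "(\<lambda>z\<in>carrier V. (\<lambda>z\<in>carrier V. x \<cdot>\<^bsub>W\<^esub> f z) z \<oplus>\<^bsub>W\<^esub> (\<lambda>z\<in>carrier V. y \<cdot>\<^bsub>W\<^esub> f z) z)
            = (\<lambda>z\<in>carrier V. (x \<oplus>\<^bsub>W\<^esub> y) \<cdot>\<^bsub>W\<^esub> f z)"
          using V.functional_closed[OF H(3)] W by (intro restrict_ext) (simp add: W.rsmult_l_distr)
        finally show ?thesis .
      qed
      then have "gen (x \<oplus>\<^bsub>W\<^esub> y) (S \<union> T)" using S T unfolding gen_def by blast
      then show ?thesis using W unfolding Q_def by auto
    qed
    show "x \<cdot>\<^bsub>W\<^esub> a \<in> Q" if x: "x \<in> Q" and a: "a \<in> carrier D" for x a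
    proof -
      obtain S where S: "gen x S" and W: "x \<in> carrier W" using x unfolding Q_def by auto
      have "(\<lambda>z\<in>carrier V. (x \<cdot>\<^bsub>W\<^esub> a) \<cdot>\<^bsub>W\<^esub> f z) \<in> H"
        if H: "right_submodule H (End_ring D V) (Hom_right D V W)" "S \<subseteq> H" "functional D V f" for H f
      proof -
        \<comment> \<open>The scalar moves from the vector into the functional; this is why
          \<open>gen\<close> quantifies over all functionals for one \<open>S\<close>.\<close>
        have "(\<lambda>z\<in>carrier V. (x \<cdot>\<^bsub>W\<^esub> a) \<cdot>\<^bsub>W\<^esub> f z) = (\<lambda>z\<in>carrier V. x \<cdot>\<^bsub>W\<^esub> (a \<otimes>\<^bsub>D\<^esub> f z))"
          using V.functional_closed[OF H(3)] W a by (intro restrict_ext) (simp add: W.rsmult_assoc)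
        then show ?thesis using genE[OF S H(1,2) V.functional_lmult[OF H(3) a]] by simp
      qed
      then have "gen (x \<cdot>\<^bsub>W\<^esub> a) S" using S unfolding gen_def by blast
      then show ?thesis using W a unfolding Q_def by auto
    qed
  qed (auto simp: Q_def)
  moreover have "{A x | A x. A \<in> I \<and> x \<in> carrier V} \<subseteq> Q"
  proof clarify
    fix A x assume A: "A \<in> I" and x: "x \<in> carrier V"
    then have AL: "A \<in> lin_maps D V W" using I by auto
    have "(\<lambda>z\<in>carrier V. A x \<cdot>\<^bsub>W\<^esub> f z) \<in> H"
      if H: "right_submodule H (End_ring D V) (Hom_right D V W)" "{A} \<subseteq> H" "functional D V f" for H f
    proof -
      have "compose (carrier V) A (\<lambda>z\<in>carrier V. x \<cdot>\<^bsub>V\<^esub> f z) \<in> H"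
        using H x by (intro right_submodule_HomE(4)[OF H(1)] VV.rsmult_functional_lin_maps) auto
      also have "compose (carrier V) A (\<lambda>z\<in>carrier V. x \<cdot>\<^bsub>V\<^esub> f z) = (\<lambda>z\<in>carrier V. A x \<cdot>\<^bsub>W\<^esub> f z)"
        unfolding compose_def using lin_mapsE(4)[OF AL x] V.functional_closed[OF H(3)]
        by (intro restrict_ext) simp
      finally show ?thesis .
    qed
    then have "gen (A x) {A}" using A unfolding gen_def by blast
    then show "A x \<in> Q" using lin_mapsE(2)[OF AL x] unfolding Q_def by auto
  qed
  ultimately have "w \<in> Q"
    using w W.right_span_minimal unfolding im_fam_def by blast
  then show thesis using that unfolding Q_def gen_def by blast
qed

lemma right_version:
  assumes I: "right_submodule I (End_ring D V) (Hom_right D V W)"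
    and fin: "fin_dim D (W\<lparr>carrier := im_fam D V W I\<rparr>)"
  shows "right_fin_gen (End_ring D V) (Hom_right D V W) I"
    and "I = {T \<in> lin_maps D V W. T ` carrier V \<subseteq> im_fam D V W I}"
    and "vdim D W \<le>o vdim D V \<Longrightarrow> right_principal (End_ring D V) (Hom_right D V W) I"
proof -
  define U where "U = im_fam D V W I"
  note IL = right_submodule_HomE(1)[OF I]
  have U: "right_submodule U D W" unfolding U_def by (rule right_submodule_im_fam[OF IL])
  note UE = W.right_submoduleE[OF U]
  obtain B where B: "finite B" "is_basis D (W\<lparr>carrier := U\<rparr>) B"
    using fin unfolding fin_dim_def U_def by auto
  note BU = W.submodule_basis_span[OF U B(2)]
  \<comment> \<open>The Gram-Schmidt process is run with all functionals on \<open>W\<close> and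
    with the zero subspace for \<open>K\<close>; functionals separate nonzero vectors from
    zero.\<close>
  have "\<exists>E f. dual_basis D W E f \<and> E \<subseteq> U \<and> f \<in> E \<rightarrow> {f. functional D W f} \<and>
    (\<forall>x\<in>B. x \<ominus>\<^bsub>W\<^esub> lin_comb W W E (\<lambda>e. e) f x \<in> {\<zero>\<^bsub>W\<^esub>})"
  proof (rule W.dual_basis_exists[OF _ _ _ U W.right_submodule_zero _ _ B(1) BU(1)])
    show "\<exists>g\<in>{f. functional D W f}. g x \<noteq> \<zero>\<^bsub>D\<^esub>" if "x \<in> U" "x \<notin> {\<zero>\<^bsub>W\<^esub>}" for x
      using W.functional_separates[of x] that UE(1) by blast
  qed (auto intro: W.functional_lmult_diff W.functional_lmult W.functional_zero)
  then obtain E f where E: "dual_basis D W E f" "E \<subseteq> U"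
    and res: "\<And>x. x \<in> B \<Longrightarrow> x \<ominus>\<^bsub>W\<^esub> lin_comb W W E (\<lambda>e. e) f x = \<zero>\<^bsub>W\<^esub>" by blast
  note EE = W.dual_basisE[OF E(1)]
  \<comment> \<open>Residuals vanish on \<open>B\<close>, hence on its span, so the projection is
    the identity on \<open>U\<close>.\<close>
  have proj: "lin_comb W W E (\<lambda>e. e) f u = u" if u: "u \<in> U" for u
  proof -
    have "right_span D W B \<subseteq> {x \<in> carrier W. x \<ominus>\<^bsub>W\<^esub> lin_comb W W E (\<lambda>e. e) f x \<in> {\<zero>\<^bsub>W\<^esub>}}"
      using res BU(1) UE(1)
      by (intro W.right_span_minimal W.residual_submodule[OF E(1) W.right_submodule_zero]) auto
    then have uW: "u \<in> carrier W" "u \<ominus>\<^bsub>W\<^esub> lin_comb W W E (\<lambda>e. e) f u = \<zero>\<^bsub>W\<^esub>"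
      using BU(2) u by auto
    have "lin_comb W W E (\<lambda>e. e) f u \<in> carrier W"
      using EE uW by (intro lin_mapsE(2)[OF WW.lin_comb_lin_maps]) auto
    then show ?thesis
      using uW W.M.minus_equality[of u "\<ominus>\<^bsub>W\<^esub> lin_comb W W E (\<lambda>e. e) f u"]
      by (simp add: W.M.minus_eq)
  qed
  have im: "T x \<in> U" if "T \<in> I" "x \<in> carrier V" for T x
    unfolding U_def im_fam_def using that by (intro subsetD[OF W.right_span_superset]) auto
  have T_eq: "T = lin_comb V W E (\<lambda>e. e) (\<lambda>e x. f e (T x))"
    if T: "T \<in> lin_maps D V W" "T ` carrier V \<subseteq> U" for T
  proof (rule extensionalityI[OF lin_mapsE(1)[OF T(1)]])
    show "lin_comb V W E (\<lambda>e. e) (\<lambda>e x. f e (T x)) \<in> extensional (carrier V)"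
      by (simp add: lin_comb_def)
    fix x assume x: "x \<in> carrier V"
    then have "T x \<in> U" "T x \<in> carrier W" using T(2) UE(1) by auto
    then show "T x = lin_comb V W E (\<lambda>e. e) (\<lambda>e x. f e (T x)) x"
      using proj[of "T x"] x by (simp add: lin_comb_def)
  qed
  have fT: "functional D V (\<lambda>x. f e (T x))" if "T \<in> lin_maps D V W" "e \<in> E" for T e
    using functional_comp[OF that(1) EE(3)[OF that(2)]] .
  have "\<exists>S. finite S \<and> S \<subseteq> I \<and> (\<forall>H h. right_submodule H (End_ring D V) (Hom_right D V W) \<and> S \<subseteq> H \<and>
      functional D V h \<longrightarrow> (\<lambda>x\<in>carrier V. e \<cdot>\<^bsub>W\<^esub> h x) \<in> H)" if "e \<in> E" for e
  proof -
    have "e \<in> im_fam D V W I" using that E(2) unfolding U_def by auto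
    from im_fam_rank_one[OF IL this] show ?thesis by metis
  qed
  then obtain S where S: "\<And>e. e \<in> E \<Longrightarrow> finite (S e)" "\<And>e. e \<in> E \<Longrightarrow> S e \<subseteq> I"
    "\<And>e H h. \<lbrakk>e \<in> E; right_submodule H (End_ring D V) (Hom_right D V W); S e \<subseteq> H; functional D V h\<rbrakk>
      \<Longrightarrow> (\<lambda>x\<in>carrier V. e \<cdot>\<^bsub>W\<^esub> h x) \<in> H" by metis
  define S' where "S' = (\<Union>e\<in>E. S e)"
  have S': "finite S'" "S' \<subseteq> I" using S EE(1) unfolding S'_def by auto
  \<comment> \<open>Every submodule above \<open>S'\<close> contains every map with values in
    \<open>U\<close>. Taken at \<open>I\<close> itself, this gives the description of
    \<open>I\<close>; taken over all \<open>H\<close>, it shows that \<open>S'\<close>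
    generates.\<close>
  have sup: "T \<in> H" if H: "right_submodule H (End_ring D V) (Hom_right D V W)" "S' \<subseteq> H"
    and T: "T \<in> lin_maps D V W" "T ` carrier V \<subseteq> U" for T H
  proof (subst T_eq[OF T], rule lin_comb_mem[OF EE(1,5) fT[OF T(1)] right_submodule_HomE(2,3)[OF H(1)]])
    show "(\<lambda>x\<in>carrier V. e \<cdot>\<^bsub>W\<^esub> f e (T x)) \<in> H" if "e \<in> E" for e
      using S(3)[OF that H(1) _ fT[OF T(1) that]] H(2) that unfolding S'_def by auto
  qed
  show I_eq: "I = {T \<in> lin_maps D V W. T ` carrier V \<subseteq> im_fam D V W I}"
    using sup[OF I S'(2)] im IL unfolding U_def by blast
  have "I = right_span (End_ring D V) (Hom_right D V W) S'"
    unfolding right_span_def hull_def using sup im IL I S'(2) by blast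
  then show "right_fin_gen (End_ring D V) (Hom_right D V W) I"
    using S' unfolding right_fin_gen_def by blast
  show "right_principal (End_ring D V) (Hom_right D V W) I" if le: "vdim D W \<le>o vdim D V"
  proof -
    obtain g \<phi> where g: "inj_on g E" "dual_basis D V (g ` E) \<phi>"
      using WV.dual_basis_transfer[OF E(1) le] .
    note GE = V.dual_basisE[OF g(2)]
    \<comment> \<open>\<open>A\<close> is built so as to send \<open>g e\<close> to
      \<open>e\<close>; injectivity of \<open>g\<close> makes the functionals
      \<open>\<phi> (g e)\<close> distinguish the indices.\<close>
    define A where "A = lin_comb V W E (\<lambda>e. e) (\<lambda>e. \<phi> (g e))"
    have AL: "A \<in> lin_maps D V W"
      unfolding A_def using EE GE by (intro lin_comb_lin_maps) auto
    have "A x \<in> U" if x: "x \<in> carrier V" for x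
      unfolding A_def lin_comb_apply[OF x] using EE(1) E(2) V.functional_closed[OF GE(3)] x
      by (intro W.right_submodule_finsum[OF U]) (auto intro!: UE(6))
    then have AI: "A \<in> I" using I_eq AL unfolding U_def by auto
    have Ag: "A (g e) = e" if "e \<in> E" for e
      unfolding A_def using GE g(1) that by (intro lin_comb_eqI EE(1,5)) (auto simp: inj_on_eq_iff)
    have "T \<in> H" if H: "right_submodule H (End_ring D V) (Hom_right D V W)" "A \<in> H" and T: "T \<in> I" for H T
    proof -
      have TL: "T \<in> lin_maps D V W" "T ` carrier V \<subseteq> U" using T im IL by auto
      \<comment> \<open>The right multiplier sends \<open>x\<close> to the sum of the
        \<open>g e \<cdot> f e (T x)\<close>. Then \<open>A\<close> replaces each \<open>g e\<close>
        by \<open>e\<close>, which restores \<open>T\<close>.\<close>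
      have CL: "lin_comb V V E g (\<lambda>e x. f e (T x)) \<in> lin_maps D V V"
        using GE(2) by (intro VV.lin_comb_lin_maps EE(1) fT[OF TL(1)]) auto
      have "compose (carrier V) A (lin_comb V V E g (\<lambda>e x. f e (T x))) =
          lin_comb V W E (\<lambda>e. A (g e)) (\<lambda>e x. f e (T x))"
        using EE GE(2) V.functional_closed[OF fT[OF TL(1)]] by (intro compose_lin_comb[OF AL]) auto
      also have "\<dots> = lin_comb V W E (\<lambda>e. e) (\<lambda>e x. f e (T x))"
        unfolding lin_comb_def using EE(2) V.functional_closed[OF fT[OF TL(1)]]
        by (intro restrict_ext W.M.finsum_cong') (auto simp: Ag)
      also have "\<dots> = T" by (rule T_eq[OF TL, symmetric])
      finally show ?thesis using right_submodule_HomE(4)[OF H CL] by simp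
    qed
    then have "I = right_span (End_ring D V) (Hom_right D V W) {A}"
      unfolding right_span_def hull_def using I AI by blast
    then show ?thesis using AI unfolding right_principal_def by blast
  qed
qed

section \<open>The left version\<close>

lemma right_submodule_ker_fam:
  assumes "I \<subseteq> lin_maps D V W"
  shows "right_submodule (ker_fam V W I) D V"
proof (rule V.right_submoduleI)
  have L: "A \<in> lin_maps D V W" if "A \<in> I" for A using assms that by auto
  show "\<zero>\<^bsub>V\<^esub> \<in> ker_fam V W I"
    using lin_maps_zero[OF L] unfolding ker_fam_def by simp
  show "x \<oplus>\<^bsub>V\<^esub> y \<in> ker_fam V W I" if "x \<in> ker_fam V W I" "y \<in> ker_fam V W I" for x y
  proof -
    have "A (x \<oplus>\<^bsub>V\<^esub> y) = \<zero>\<^bsub>W\<^esub>" if A: "A \<in> I" for A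
    proof -
      have "x \<in> carrier V" "A x = \<zero>\<^bsub>W\<^esub>" "y \<in> carrier V" "A y = \<zero>\<^bsub>W\<^esub>"
        using \<open>x \<in> ker_fam V W I\<close> \<open>y \<in> ker_fam V W I\<close> A unfolding ker_fam_def by blast+
      then show ?thesis using lin_mapsE(3)[OF L[OF A], of x y] by simp
    qed
    then show ?thesis using that unfolding ker_fam_def by simp
  qed
  show "x \<cdot>\<^bsub>V\<^esub> a \<in> ker_fam V W I" if "x \<in> ker_fam V W I" "a \<in> carrier D" for x a
  proof -
    have "A (x \<cdot>\<^bsub>V\<^esub> a) = \<zero>\<^bsub>W\<^esub>" if A: "A \<in> I" for A
    proof -
      have "x \<in> carrier V" "A x = \<zero>\<^bsub>W\<^esub>"
        using \<open>x \<in> ker_fam V W I\<close> A unfolding ker_fam_def by blast+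
      then show ?thesis using lin_mapsE(4)[OF L[OF A], of x a] \<open>a \<in> carrier D\<close> by simp
    qed
    then show ?thesis using that unfolding ker_fam_def by simp
  qed
qed (auto simp: ker_fam_def)

lemma left_version:
  assumes I: "submodule I (End_ring D W) (Hom_left D V W)"
    and fin: "fin_dim D (coim_fam V W I)"
  shows "left_fin_gen (End_ring D W) (Hom_left D V W) I"
    and "I = {T \<in> lin_maps D V W. T ` ker_fam V W I = {\<zero>\<^bsub>W\<^esub>}}"
    and "vdim D V \<le>o vdim D W \<Longrightarrow> left_principal (End_ring D W) (Hom_left D V W) I"
proof -
  let ?sub = "\<lambda>H. submodule H (End_ring D W) (Hom_left D V W)"
  define K where "K = ker_fam V W I"
  note IL = submodule_HomE(1)[OF I]
  have K: "right_submodule K D V" unfolding K_def by (rule right_submodule_ker_fam[OF IL])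
  note KE = V.right_submoduleE[OF K]
  \<comment> \<open>Compared with the right version, vectors and functionals change places: one
    \<open>S\<close> belongs to a functional and serves all vectors \<open>w\<close>.\<close>
  define gen where "gen g S \<longleftrightarrow> finite S \<and> S \<subseteq> I \<and>
    (\<forall>H w. ?sub H \<and> S \<subseteq> H \<and> w \<in> carrier W \<longrightarrow> (\<lambda>x\<in>carrier V. w \<cdot>\<^bsub>W\<^esub> g x) \<in> H)" for g S
  have genE: "(\<lambda>x\<in>carrier V. w \<cdot>\<^bsub>W\<^esub> g x) \<in> H" if "gen g S" "?sub H" "S \<subseteq> H" "w \<in> carrier W"
    for g S H w
    using that unfolding gen_def by blast
  \<comment> \<open>These functionals feed the Gram-Schmidt process. For that,
    \<open>\<Lambda>\<close> has to be closed under the two operations \<open>diff\<close> and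
    \<open>lmult\<close> and to detect every vector outside \<open>K\<close>.\<close>
  define \<Lambda> where "\<Lambda> = {g. functional D V g \<and> (\<forall>x\<in>K. g x = \<zero>\<^bsub>D\<^esub>) \<and> (\<exists>S. gen g S)}"
  have diff: "(\<lambda>x. g x \<ominus>\<^bsub>D\<^esub> a \<otimes>\<^bsub>D\<^esub> h x) \<in> \<Lambda>" if g: "g \<in> \<Lambda>" and h: "h \<in> \<Lambda>" and a: "a \<in> carrier D" for g h a
  proof -
    obtain S T where S: "gen g S" and T: "gen h T" and gh: "functional D V g" "functional D V h"
      using g h unfolding \<Lambda>_def by auto
    have "(\<lambda>x\<in>carrier V. w \<cdot>\<^bsub>W\<^esub> (g x \<ominus>\<^bsub>D\<^esub> a \<otimes>\<^bsub>D\<^esub> h x)) \<in> H"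
      if H: "?sub H" "S \<union> T \<subseteq> H" and w: "w \<in> carrier W" for H w
    proof -
      \<comment> \<open>The left factor of \<open>h\<close> moves over to the vector:
        \<open>w (g - a h)\<close> is \<open>w g\<close> plus \<open>(w (-a)) h\<close>.\<close>
      have "(\<lambda>x\<in>carrier V. (\<lambda>x\<in>carrier V. w \<cdot>\<^bsub>W\<^esub> g x) x \<oplus>\<^bsub>W\<^esub>
          (\<lambda>x\<in>carrier V. (w \<cdot>\<^bsub>W\<^esub> (\<ominus>\<^bsub>D\<^esub> a)) \<cdot>\<^bsub>W\<^esub> h x) x) \<in> H"
        using H w a by (intro submodule_HomE(3)[OF H(1)] genE[OF S H(1)] genE[OF T H(1)]) auto
      also have "(\<lambda>x\<in>carrier V. (\<lambda>x\<in>carrier V. w \<cdot>\<^bsub>W\<^esub> g x) x \<oplus>\<^bsub>W\<^esub>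
          (\<lambda>x\<in>carrier V. (w \<cdot>\<^bsub>W\<^esub> (\<ominus>\<^bsub>D\<^esub> a)) \<cdot>\<^bsub>W\<^esub> h x) x)
          = (\<lambda>x\<in>carrier V. w \<cdot>\<^bsub>W\<^esub> (g x \<ominus>\<^bsub>D\<^esub> a \<otimes>\<^bsub>D\<^esub> h x))"
        using V.functional_closed[OF gh(1)] V.functional_closed[OF gh(2)] w a
        by (intro restrict_ext)
          (simp add: a_minus_def W.rsmult_r_distr V.R.l_minus flip: W.rsmult_assoc)
      finally show ?thesis .
    qed
    then have "gen (\<lambda>x. g x \<ominus>\<^bsub>D\<^esub> a \<otimes>\<^bsub>D\<^esub> h x) (S \<union> T)"
      using S T unfolding gen_def by blast
    then show ?thesis
      using g h a V.functional_lmult_diff unfolding \<Lambda>_def by (auto simp: V.R.minus_eq)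
  qed
  have lmult: "(\<lambda>x. a \<otimes>\<^bsub>D\<^esub> g x) \<in> \<Lambda>" if g: "g \<in> \<Lambda>" and a: "a \<in> carrier D" for g a
  proof -
    obtain S where S: "gen g S" and gf: "functional D V g" using g unfolding \<Lambda>_def by auto
    have "(\<lambda>x\<in>carrier V. w \<cdot>\<^bsub>W\<^esub> (a \<otimes>\<^bsub>D\<^esub> g x)) \<in> H"
      if H: "?sub H" "S \<subseteq> H" and w: "w \<in> carrier W" for H w
    proof -
      have "(\<lambda>x\<in>carrier V. w \<cdot>\<^bsub>W\<^esub> (a \<otimes>\<^bsub>D\<^esub> g x)) = (\<lambda>x\<in>carrier V. (w \<cdot>\<^bsub>W\<^esub> a) \<cdot>\<^bsub>W\<^esub> g x)"
        using V.functional_closed[OF gf] w a by (intro restrict_ext) (simp add: W.rsmult_assoc)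
      then show ?thesis using genE[OF S H W.rsmult_closed[OF w a]] by simp
    qed
    then have "gen (\<lambda>x. a \<otimes>\<^bsub>D\<^esub> g x) S" using S unfolding gen_def by blast
    then show ?thesis using g a V.functional_lmult unfolding \<Lambda>_def by auto
  qed
  have sep: "\<exists>g\<in>\<Lambda>. g x \<noteq> \<zero>\<^bsub>D\<^esub>" if x: "x \<in> carrier V" "x \<notin> K" for x
  proof -
    \<comment> \<open>Some \<open>A\<close> in \<open>I\<close> does not kill \<open>x\<close>, and
      a functional \<open>\<phi>\<close> detects \<open>A x\<close>. The functional
      \<open>\<phi> \<circ> A\<close> belongs to \<open>\<Lambda>\<close> with generating set
      \<open>{A}\<close>, because \<open>w \<cdot> \<phi> (A z)\<close> is a left multiple of
      \<open>A\<close>.\<close>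
    obtain A where A: "A \<in> I" "A x \<noteq> \<zero>\<^bsub>W\<^esub>" using x unfolding K_def ker_fam_def by auto
    then have AL: "A \<in> lin_maps D V W" using IL by auto
    obtain \<phi> where \<phi>: "functional D W \<phi>" "\<phi> (A x) \<noteq> \<zero>\<^bsub>D\<^esub>"
      using W.functional_separates[OF lin_mapsE(2)[OF AL x(1)] A(2)] .
    have "(\<lambda>z\<in>carrier V. w \<cdot>\<^bsub>W\<^esub> \<phi> (A z)) \<in> H"
      if H: "?sub H" "{A} \<subseteq> H" and w: "w \<in> carrier W" for H w
    proof -
      have "compose (carrier V) (\<lambda>y\<in>carrier W. w \<cdot>\<^bsub>W\<^esub> \<phi> y) A \<in> H"
        using H w \<phi> by (intro submodule_HomE(4)[OF H(1)] WW.rsmult_functional_lin_maps) auto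
      also have "compose (carrier V) (\<lambda>y\<in>carrier W. w \<cdot>\<^bsub>W\<^esub> \<phi> y) A = (\<lambda>z\<in>carrier V. w \<cdot>\<^bsub>W\<^esub> \<phi> (A z))"
        unfolding compose_def using lin_mapsE(2)[OF AL] by (intro restrict_ext) simp
      finally show ?thesis .
    qed
    then have "gen (\<lambda>z. \<phi> (A z)) {A}" using A unfolding gen_def by blast
    moreover have "\<phi> (A k) = \<zero>\<^bsub>D\<^esub>" if "k \<in> K" for k
      using that A(1) W.functional_zero[OF \<phi>(1)] unfolding K_def ker_fam_def by simp
    ultimately have "(\<lambda>z. \<phi> (A z)) \<in> \<Lambda>"
      using functional_comp[OF AL \<phi>(1)] unfolding \<Lambda>_def by blast
    then show ?thesis using \<phi>(2) by (intro bexI[of _ "\<lambda>z. \<phi> (A z)"]) auto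
  qed
  obtain F where F: "finite F" "F \<subseteq> carrier V"
    and FV: "\<And>P. \<lbrakk>right_submodule P D V; K \<subseteq> P; F \<subseteq> P\<rbrakk> \<Longrightarrow> P = carrier V"
    using V.fin_dim_quotE[OF K] fin unfolding coim_fam_def K_def by metis
  have "\<exists>E f. dual_basis D V E f \<and> E \<subseteq> carrier V \<and> f \<in> E \<rightarrow> \<Lambda> \<and>
    (\<forall>x\<in>F. x \<ominus>\<^bsub>V\<^esub> lin_comb V V E (\<lambda>e. e) f x \<in> K)"
    by (rule V.dual_basis_exists[OF _ diff lmult V.right_submodule_carrier K _ sep F])
      (auto simp: \<Lambda>_def)
  then obtain E f where E: "dual_basis D V E f" "f \<in> E \<rightarrow> \<Lambda>"
    and res: "\<And>x. x \<in> F \<Longrightarrow> x \<ominus>\<^bsub>V\<^esub> lin_comb V V E (\<lambda>e. e) f x \<in> K" by blast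
  note EE = V.dual_basisE[OF E(1)]
  have fK: "f e k = \<zero>\<^bsub>D\<^esub>" if "e \<in> E" "k \<in> K" for e k
    using E(2) that unfolding \<Lambda>_def by auto
  have lin_comb_K: "lin_comb V W E w f k = \<zero>\<^bsub>W\<^esub>" if "w \<in> E \<rightarrow> carrier W" "k \<in> K" for w k
  proof -
    have "(\<Oplus>\<^bsub>W\<^esub>e\<in>E. w e \<cdot>\<^bsub>W\<^esub> f e k) = (\<Oplus>\<^bsub>W\<^esub>e\<in>E. \<zero>\<^bsub>W\<^esub>)"
      using that fK by (intro W.M.finsum_cong') (auto simp: Pi_iff)
    then show ?thesis using that KE(1) by (auto simp: lin_comb_def)
  qed
  define P where "P = lin_comb V V E (\<lambda>e. e) f"
  have PL: "P \<in> lin_maps D V V" unfolding P_def using EE by (intro VV.lin_comb_lin_maps) auto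
  \<comment> \<open>The vectors with residual in \<open>K\<close> form a subspace containing
    \<open>F\<close>, by the Gram-Schmidt process, and \<open>K\<close>, on which the projection is
    zero. Such a subspace is all of \<open>V\<close>.\<close>
  have "{x \<in> carrier V. x \<ominus>\<^bsub>V\<^esub> P x \<in> K} = carrier V"
  proof (rule FV)
    show "right_submodule {x \<in> carrier V. x \<ominus>\<^bsub>V\<^esub> P x \<in> K} D V"
      unfolding P_def by (rule V.residual_submodule[OF E(1) K])
    show "F \<subseteq> {x \<in> carrier V. x \<ominus>\<^bsub>V\<^esub> P x \<in> K}" using F res unfolding P_def by auto
    show "K \<subseteq> {x \<in> carrier V. x \<ominus>\<^bsub>V\<^esub> P x \<in> K}"
    proof
      fix k assume k: "k \<in> K"
      then have kV: "k \<in> carrier V" using KE(1) by auto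
      have "P k = (\<Oplus>\<^bsub>V\<^esub>e\<in>E. \<zero>\<^bsub>V\<^esub>)"
        unfolding P_def VV.lin_comb_apply[OF kV] using EE(2) fK[OF _ k] by (intro V.M.finsum_cong') auto
      then show "k \<in> {x \<in> carrier V. x \<ominus>\<^bsub>V\<^esub> P x \<in> K}" using k kV by (simp add: V.M.minus_eq)
    qed
  qed
  then have resK: "x \<ominus>\<^bsub>V\<^esub> P x \<in> K" if "x \<in> carrier V" for x using that by auto
  \<comment> \<open>\<open>T\<close> kills every residual, so \<open>T\<close> equals
    \<open>T \<circ> P\<close>, and composing with \<open>P\<close> replaces each \<open>e\<close>
    by \<open>T e\<close>.\<close>
  have T_eq: "T = lin_comb V W E T f" if T: "T \<in> lin_maps D V W" "\<And>k. k \<in> K \<Longrightarrow> T k = \<zero>\<^bsub>W\<^esub>" for T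
  proof -
    have "T = compose (carrier V) T P"
    proof (rule extensionalityI[OF lin_mapsE(1)[OF T(1)] compose_extensional])
      fix x assume x: "x \<in> carrier V"
      note Px = lin_mapsE(2)[OF PL x]
      have "T x \<oplus>\<^bsub>W\<^esub> (\<ominus>\<^bsub>W\<^esub> T (P x)) = \<zero>\<^bsub>W\<^esub>"
        using T(2)[OF resK[OF x]] x Px
        by (simp add: V.M.minus_eq lin_mapsE(3)[OF T(1)] lin_maps_minus[OF T(1)])
      then have "T x = T (P x)"
        using W.M.minus_equality[of "T x" "\<ominus>\<^bsub>W\<^esub> T (P x)"] lin_mapsE(2)[OF T(1)] x Px by simp
      then show "T x = compose (carrier V) T P x" using x by (simp add: compose_eq)
    qed
    also have "\<dots> = lin_comb V W E T f"
      unfolding P_def using EE V.functional_closed[OF EE(3)]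
      by (intro compose_lin_comb[OF T(1)]) auto
    finally show ?thesis .
  qed
  have "\<exists>S. gen (f e) S" if "e \<in> E" for e using E(2) that unfolding \<Lambda>_def by auto
  then obtain S where S: "\<And>e. e \<in> E \<Longrightarrow> gen (f e) (S e)" by metis
  define S' where "S' = (\<Union>e\<in>E. S e)"
  have S': "finite S'" "S' \<subseteq> I" using S EE(1) unfolding S'_def gen_def by auto
  \<comment> \<open>As in the right version, \<open>H = I\<close> yields the description of
    \<open>I\<close>, and all \<open>H\<close> together yield generation by
    \<open>S'\<close>.\<close>
  have sup: "T \<in> H" if H: "?sub H" "S' \<subseteq> H"
    and T: "T \<in> lin_maps D V W" "\<And>k. k \<in> K \<Longrightarrow> T k = \<zero>\<^bsub>W\<^esub>" for T H
  proof (subst T_eq[OF T], assumption, rule lin_comb_mem[OF EE(1) _ EE(3) submodule_HomE(2,3)[OF H(1)]])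
    show TE: "T \<in> E \<rightarrow> carrier W" using lin_mapsE(2)[OF T(1)] EE(2) by auto
    show "(\<lambda>x\<in>carrier V. T e \<cdot>\<^bsub>W\<^esub> f e x) \<in> H" if "e \<in> E" for e
      using genE[OF S[OF that] H(1)] H(2) that TE unfolding S'_def by auto
  qed
  have IK: "T k = \<zero>\<^bsub>W\<^esub>" if "T \<in> I" "k \<in> K" for T k
    using that unfolding K_def ker_fam_def by auto
  \<comment> \<open>The image is required to equal \<open>{\<zero>}\<close>, not merely to lie in
    it; \<open>K\<close> contains zero, so the image is never empty.\<close>
  have kill: "T ` K = {\<zero>\<^bsub>W\<^esub>} \<longleftrightarrow> (\<forall>k\<in>K. T k = \<zero>\<^bsub>W\<^esub>)" for T
    using KE(2) by auto
  show I_eq: "I = {T \<in> lin_maps D V W. T ` ker_fam V W I = {\<zero>\<^bsub>W\<^esub>}}"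
    using sup[OF I S'(2)] IK IL unfolding K_def[symmetric] kill by blast
  have "I = left_span (End_ring D W) (Hom_left D V W) S'"
    unfolding left_span_def hull_def using sup IK IL I S'(2) by blast
  then show "left_fin_gen (End_ring D W) (Hom_left D V W) I"
    using S' unfolding left_fin_gen_def by blast
  show "left_principal (End_ring D W) (Hom_left D V W) I" if le: "vdim D V \<le>o vdim D W"
  proof -
    obtain g \<phi> where g: "inj_on g E" "dual_basis D W (g ` E) \<phi>"
      using dual_basis_transfer[OF E(1) le] .
    note GE = W.dual_basisE[OF g(2)]
    have gW: "g \<in> E \<rightarrow> carrier W" using GE(2) by auto
    define A where "A = lin_comb V W E g f"
    have AL: "A \<in> lin_maps D V W"
      unfolding A_def by (rule lin_comb_lin_maps[OF EE(1) gW EE(3)])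
    \<comment> \<open>Every \<open>f e\<close> vanishes on \<open>K\<close>, so \<open>A\<close>
      does as well, and \<open>sup\<close> puts it into \<open>I\<close>.\<close>
    have AI: "A \<in> I"
      using sup[OF I S'(2) AL] lin_comb_K[OF gW] unfolding A_def by blast
    have "T \<in> H" if H: "?sub H" "A \<in> H" and T: "T \<in> I" for H T
    proof -
      have TL: "T \<in> lin_maps D V W" "\<And>k. k \<in> K \<Longrightarrow> T k = \<zero>\<^bsub>W\<^esub>" using T IK IL by auto
      have TE: "T \<in> E \<rightarrow> carrier W" using lin_mapsE(2)[OF TL(1)] EE(2) by auto
      \<comment> \<open>\<open>B\<close> sends \<open>g e\<close> to \<open>T e\<close> by means of
        the functionals dual to the vectors \<open>g e\<close>. Hence \<open>B \<circ> A\<close> has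
        the expansion of \<open>T\<close> from \<open>T_eq\<close>.\<close>
      define B where "B = lin_comb W W E T (\<lambda>e. \<phi> (g e))"
      have BL: "B \<in> lin_maps D W W"
        unfolding B_def using GE(3) by (intro WW.lin_comb_lin_maps[OF EE(1) TE]) auto
      have Bg: "B (g e) = T e" if "e \<in> E" for e
        unfolding B_def using GE gW g(1) that
        by (intro WW.lin_comb_eqI EE(1) TE) (auto simp: inj_on_eq_iff)
      have "compose (carrier V) B A = lin_comb V W E (\<lambda>e. B (g e)) f"
        unfolding A_def using EE gW V.functional_closed[OF EE(3)]
        by (intro WW.compose_lin_comb[OF BL]) auto
      also have "\<dots> = lin_comb V W E T f"
        unfolding lin_comb_def using TE V.functional_closed[OF EE(3)]
        by (intro restrict_ext W.M.finsum_cong') (auto simp: Bg)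
      also have "\<dots> = T" by (rule T_eq[OF TL, symmetric])
      finally show ?thesis using submodule_HomE(4)[OF H BL] by simp
    qed
    then have "I = left_span (End_ring D W) (Hom_left D V W) {A}"
      unfolding left_span_def hull_def using I AI by blast
    then show ?thesis using AI unfolding left_principal_def by blast
  qed
qed

end

theorem theorem1p8:
  fixes D :: "('d, 'm) ring_scheme"
    and V :: "('d, 'v, 'n) right_module_scheme"
    and W :: "('d, 'w, 'k) right_module_scheme"
  assumes "right_vector_space D V" and "right_vector_space D W"
  shows
    "(\<forall>I. right_submodule I (End_ring D V) (Hom_right D V W) \<and>
          fin_dim D (W\<lparr>carrier := im_fam D V W I\<rparr>) \<longrightarrow>
        right_fin_gen (End_ring D V) (Hom_right D V W) I \<and>
        I = {T \<in> lin_maps D V W. T ` carrier V \<subseteq> im_fam D V W I} \<and>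
        (vdim D W \<le>o vdim D V \<longrightarrow> right_principal (End_ring D V) (Hom_right D V W) I))
     \<and>
     (\<forall>I. submodule I (End_ring D W) (Hom_left D V W) \<and>
          fin_dim D (coim_fam V W I) \<longrightarrow>
        left_fin_gen (End_ring D W) (Hom_left D V W) I \<and>
        I = {T \<in> lin_maps D V W. T ` ker_fam V W I = {\<zero>\<^bsub>W\<^esub>}} \<and>
        (vdim D V \<le>o vdim D W \<longrightarrow> left_principal (End_ring D W) (Hom_left D V W) I))"
proof -
  interpret right_vector_space_pair D V W
    using assms by (simp add: right_vector_space_pair_def)
  show ?thesis
    by (intro conjI allI impI; elim conjE; erule (1) right_version left_version; assumption?)
qed

end
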